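(* (Composition-Diamond lemma for bicommutative algebras) Let $k$ be a field, $X$ a well-ordered set, $<$ a fixed monomial order on $\mathrm{NF}(X)$, $S$ a monic subset of the free bicommutative algebra $\mathrm{BC}(X)$, and $\mathrm{Id}(S)$ the ideal of $\mathrm{BC}(X)$ generated by $S$. The following are equivalent: (i) All the compositions of $S$ are trivial. (ii) $S$ is a Gröbner–Shirshov basis for $\mathrm{BC}(X)/\mathrm{Id}(S)$, that is, for every nonzero $f\in\mathrm{Id}(S)$ we have $\bar f=\bar h$ for some normal $S$-polynomial $h$. (iii) The set $\mathrm{Irr}(S)=\mathrm{NF}(X)\setminus\{\mu\in\mathrm{NF}(X)\mid \mu=\bar h,\ h\text{ is a normal }S\text{-polynomial}\}$ forms a linear basis of the algebra $\mathrm{BC}(X|S):=\mathrm{BC}(X)/\mathrm{Id}(S)$.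
   Context: A (nonassociative, not necessarily unital) algebra over a field $k$ is bicommutative if $x(yz)=y(xz)$ and $(xy)z=(xz)y$ hold identically. $\mathrm{BC}(X)$ is the free bicommutative algebra generated by $X$. $\mathbb N$ is the set of nonnegative integers. $[X]$ is the free commutative monoid on $X$, $[X]^+$ the free commutative semigroup ($[X]$ without its unit). Notation: $[a_1,\dots,a_n]_L=(\cdots((a_1a_2)a_3)\cdots a_n)$ and $[a_1,\dots,a_n]_R=(a_1(a_2\cdots(a_{n-1}a_n)\cdots))$, with $[a_1]_L=[a_1]_R=a_1$. For $u=z_1\cdots z_p$, $v=y_1\cdots y_q\in[X]^+$ ($z_i,y_j\in X$, $p,q\ge1$), $[u;v]=[z_1,\dots,z_{p-1},[z_p,y_1,\dots,y_q]_L]_R\in \mathrm{BC}(X)$; this does not depend on the ordering of the $z_i$ or of the $y_j$. $\mathrm{NF}(X)=X\cup\{[u;v]\mid u,v\in[X]^+\}$ is a linear basis of $\mathrm{BC}(X)$ with multiplication $(zy)=[z;y]$, $(z[u;v])=[zu;v]$, $([u;v]z)=[u;vz]$, $([u;v][u';v'])=[uu';vv']$ for $z,y\in X$. The length is $\ell(x)=1$ for $x\in X$ and $\ell([u;v])=\ell(u)+\ell(v)$, where $\ell(u)$ is the number of letters of $u$ with repetition. A monomial order on $\mathrm{NF}(X)$ is a well order $<$ such that $\mu<\nu$ implies $(\mu\nu')<(\nu\nu')$ and $(\nu'\mu)<(\nu'\nu)$ for all $\mu,\nu,\nu'\in\mathrm{NF}(X)$. For nonzero $f\in\mathrm{BC}(X)$,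 $\bar f$ is the largest element of $\mathrm{NF}(X)$ occurring in $f$; $f$ is monic if the coefficient of $\bar f$ is $1$. A set is monic if all its elements are nonzero and monic (the empty set is monic). Normal $S$-polynomials: every $s\in S$ is one; and if $s\in S$ with $\ell(\bar s)\ge2$, then $[z_1,\dots,z_p,[s,y_1,\dots,y_q]_L]_R$ is one for all $p,q\in\mathbb N$, $z_i,y_j\in X$. For an ideal $I$, a monic set $S$ is a Gröbner–Shirshov basis for $\mathrm{BC}(X)/I$ if $\mathrm{Id}(S)=I$ and every nonzero $f\in I$ satisfies $\bar f=\bar h$ for some normal $S$-polynomial $h$. Least common multiple: $\mathrm{lcm}([u;v],[u';v'])=[\mathrm{lcm}(u,u');\mathrm{lcm}(v,v')]$ with $\mathrm{lcm}$ in $[X]$. Compositions of $S$, for $f,g\in S$: (1) If $\ell(\bar f)=1$, then for every $z\in X$: $(zf)$ (left multiplication composition) and $(fz)$ (right multiplication composition). (2) If $\bar f=\bar g\in X$: $(f,g)_{\bar f}=f-g$ (inclusion composition). (3) If $\ell(\bar f)\ge2$ and $f$ does not lie in the linear span of $\mathrm{NF}(X)\setminus X$, then for all $y,z\in X$: $(f,f)_{\overline{(y(fz))}}=(y(fz))-((yf)z)$ (multiplication composition). (4) If $\bar f=[u;v]$, $\bar g=[u';v']$ with $u,v,u',v'\in[X]^+$ and $\ell(\mathrm{lcm}(\bar f,\bar g))<\ell(\bar f)+\ell(\bar g)$, write $\mathrm{lcm}(u,u')=ua_1\cdots a_p=u'b_1\cdots b_m$ and $\mathrm{lcm}(v,v')=vc_1\cdots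 c_q=v'd_1\cdots d_n$ with letters $a_i,b_i,c_i,d_i\in X$ and $p,q,m,n\in\mathbb N$; then $(f,g)_{\mathrm{lcm}(\bar f,\bar g)}=[a_1,\dots,a_p,[f,c_1,\dots,c_q]_L]_R-[b_1,\dots,b_m,[g,d_1,\dots,d_n]_L]_R$ (intersection composition). A composition $h$ of type (1) is trivial if $h$ is a linear combination of normal $S$-polynomials with leading monomials $\le\bar h$. A composition $(f_1,f_2)_\mu$ of type (2)–(4) is trivial if it is a linear combination of normal $S$-polynomials with leading monomials $<\mu$. (The zero polynomial is trivial, as an empty combination.) *)

theory Defs
  imports Complex_Main "HOL-Library.Multiset" "HOL-Library.Poly_Mapping"
begin

section \<open>Bicommutative algebras\<close>

text \<open>Algebras are neither associative nor unital, so the multiplication is an explicit parameter.\<close>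

locale bicommutative_algebra = vector_space scale
  for scale :: "'k::field \<Rightarrow> 'a::ab_group_add \<Rightarrow> 'a" +
  fixes mult :: "'a \<Rightarrow> 'a \<Rightarrow> 'a"
  assumes mult_add_left: "mult (a + b) c = mult a c + mult b c"
    and mult_add_right: "mult a (b + c) = mult a b + mult a c"
    and mult_scale_left: "mult (scale r a) b = scale r (mult a b)"
    and mult_scale_right: "mult a (scale r b) = scale r (mult a b)"
    and left_commutative: "mult x (mult y z) = mult y (mult x z)"
    and right_commutative: "mult (mult x y) z = mult (mult x z) y"


section \<open>The normal forms $\mathrm{NF}(X)$\<close>

text \<open>
  The generating set $X$ is the type \<^typ>\<open>'x\<close>. The free commutative monoid $[X]$ is the type
  \<^typ>\<open>'x multiset\<close>, and the free commutative semigroup $[X]^+$ is the following type; both are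
  written additively.
\<close>

typedef 'x cword = "{u :: 'x multiset. u \<noteq> {#}}"
  morphisms letters Abs_cword
  by (rule exI[of _ "{#undefined#}"]) simp

setup_lifting type_definition_cword

instantiation cword :: (type) ab_semigroup_add
begin
lift_definition plus_cword :: "'x cword \<Rightarrow> 'x cword \<Rightarrow> 'x cword" is "(+)" by simp
instance by standard (transfer; simp add: ac_simps)+
end

lift_definition letter :: "'x \<Rightarrow> 'x cword" is "\<lambda>x. {#x#}" by simp

text \<open>The least common multiple in $[X]$ takes maxima of multiplicities.\<close>

lift_definition cword_lcm :: "'x cword \<Rightarrow> 'x cword \<Rightarrow> 'x cword" is "(\<union>#)"
  by (metis mem_Collect_eq subset_mset.sup_eq_bot_iff)

text \<open>\<open>Gen x\<close> is the generator $x$ and \<open>Br u v\<close> is $[u;v]$ (see \<open>bc_single_Br\<close> below).\<close>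

datatype 'x nf = Gen 'x | Br "'x cword" "'x cword"

text \<open>The product of two elements of $\mathrm{NF}(X)$, which is again in $\mathrm{NF}(X)$.\<close>

fun nf_mult :: "'x nf \<Rightarrow> 'x nf \<Rightarrow> 'x nf" where
  "nf_mult (Gen z) (Gen y) = Br (letter z) (letter y)"
| "nf_mult (Gen z) (Br u v) = Br (letter z + u) v"
| "nf_mult (Br u v) (Gen z) = Br u (v + letter z)"
| "nf_mult (Br u v) (Br u' v') = Br (u + u') (v + v')"

fun nf_length :: "'x nf \<Rightarrow> nat" where
  "nf_length (Gen x) = 1"
| "nf_length (Br u v) = size (letters u) + size (letters v)"


section \<open>The free bicommutative algebra $\mathrm{BC}(X)$\<close>

text \<open>
  $\mathrm{BC}(X)$ is realised on its linear basis $\mathrm{NF}(X)$: an element is a finitely supported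
  function \<^typ>\<open>'x nf \<Rightarrow>\<^sub>0 'k\<close>. The theorems \<open>bicommutative_algebra_bc\<close> and \<open>bc_free\<close> below
  establish that this is the free bicommutative algebra generated by $X$.
\<close>

type_synonym ('x, 'k) bc = "'x nf \<Rightarrow>\<^sub>0 'k"

definition bc_scale :: "'k::field \<Rightarrow> ('x, 'k) bc \<Rightarrow> ('x, 'k) bc" where
  "bc_scale c f = Poly_Mapping.map ((*) c) f"

definition bc_mult :: "('x, 'k::field) bc \<Rightarrow> ('x, 'k) bc \<Rightarrow> ('x, 'k) bc"  (infixl \<open>\<star>\<close> 70) where
  "f \<star> g = (\<Sum>\<mu>\<in>Poly_Mapping.keys f. \<Sum>\<nu>\<in>Poly_Mapping.keys g.
     Poly_Mapping.single (nf_mult \<mu> \<nu>) (Poly_Mapping.lookup f \<mu> * Poly_Mapping.lookup g \<nu>))"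

abbreviation nf :: "'x nf \<Rightarrow> ('x, 'k::field) bc" where
  "nf \<mu> \<equiv> Poly_Mapping.single \<mu> 1"

abbreviation gen :: "'x \<Rightarrow> ('x, 'k::field) bc" where
  "gen x \<equiv> nf (Gen x)"

lemma lookup_bc_scale [simp]:
  "Poly_Mapping.lookup (bc_scale c f) \<mu> = c * Poly_Mapping.lookup f \<mu>"
  by (simp add: bc_scale_def Poly_Mapping.map.rep_eq when_def)

global_interpretation bc: vector_space "bc_scale :: 'k::field \<Rightarrow> ('x, 'k) bc \<Rightarrow> ('x, 'k) bc"
  by unfold_locales
    (auto intro!: poly_mapping_eqI simp: lookup_add algebra_simps)

text \<open>
  \<open>left_normed s [y\<^sub>1,\<dots>,y\<^sub>q]\<close> is $[s,y_1,\dots,y_q]_L$ and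
  \<open>right_normed [z\<^sub>1,\<dots>,z\<^sub>p] t\<close> is $[z_1,\dots,z_p,t]_R$.
\<close>

definition left_normed :: "('x, 'k::field) bc \<Rightarrow> 'x list \<Rightarrow> ('x, 'k) bc" where
  "left_normed s ys = foldl (\<star>) s (map gen ys)"

definition right_normed :: "'x list \<Rightarrow> ('x, 'k::field) bc \<Rightarrow> ('x, 'k) bc" where
  "right_normed zs t = foldr (\<star>) (map gen zs) t"


subsection \<open>Freeness\<close>

lemma bc_mult_superset:
  assumes "finite A" "finite B" "Poly_Mapping.keys f \<subseteq> A" "Poly_Mapping.keys g \<subseteq> B"
  shows "f \<star> g = (\<Sum>\<mu>\<in>A. \<Sum>\<nu>\<in>B.
     Poly_Mapping.single (nf_mult \<mu> \<nu>) (Poly_Mapping.lookup f \<mu> * Poly_Mapping.lookup g \<nu>))"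
proof -
  have "f \<star> g = (\<Sum>\<mu>\<in>Poly_Mapping.keys f. \<Sum>\<nu>\<in>B.
     Poly_Mapping.single (nf_mult \<mu> \<nu>) (Poly_Mapping.lookup f \<mu> * Poly_Mapping.lookup g \<nu>))"
    unfolding bc_mult_def
    by (intro sum.cong refl sum.mono_neutral_left) (use assms in \<open>auto simp: in_keys_iff\<close>)
  also have "\<dots> = (\<Sum>\<mu>\<in>A. \<Sum>\<nu>\<in>B.
     Poly_Mapping.single (nf_mult \<mu> \<nu>) (Poly_Mapping.lookup f \<mu> * Poly_Mapping.lookup g \<nu>))"
    by (intro sum.mono_neutral_left) (use assms in \<open>auto simp: in_keys_iff\<close>)
  finally show ?thesis .
qed

lemma bc_mult_add_left: "(f + g) \<star> h = f \<star> h + g \<star> h"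
proof -
  let ?A = "Poly_Mapping.keys f \<union> Poly_Mapping.keys g" and ?B = "Poly_Mapping.keys h"
  have "Poly_Mapping.keys (f + g) \<subseteq> ?A" by (rule Poly_Mapping.keys_add)
  then show ?thesis
    by (simp add: bc_mult_superset[of ?A ?B] lookup_add algebra_simps single_add sum.distrib)
qed

lemma bc_mult_add_right: "h \<star> (f + g) = h \<star> f + h \<star> g"
proof -
  let ?A = "Poly_Mapping.keys f \<union> Poly_Mapping.keys g" and ?B = "Poly_Mapping.keys h"
  have "Poly_Mapping.keys (f + g) \<subseteq> ?A" by (rule Poly_Mapping.keys_add)
  then show ?thesis
    by (simp add: bc_mult_superset[of ?B ?A] lookup_add algebra_simps single_add sum.distrib)
qed

lemma bc_scale_single: "bc_scale c (Poly_Mapping.single \<mu> a) = Poly_Mapping.single \<mu> (c * a)"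
  by (rule poly_mapping_eqI) (simp add: lookup_single when_def)

lemma keys_bc_scale: "Poly_Mapping.keys (bc_scale c f) \<subseteq> Poly_Mapping.keys f"
  by (auto simp: in_keys_iff)

lemma bc_mult_scale_left: "bc_scale c f \<star> h = bc_scale c (f \<star> h)"
  using keys_bc_scale[of c f]
  by (simp add: bc_mult_superset[of "Poly_Mapping.keys f" "Poly_Mapping.keys h"]
      bc.scale_sum_right bc_scale_single algebra_simps)

lemma bc_mult_scale_right: "h \<star> bc_scale c f = bc_scale c (h \<star> f)"
  using keys_bc_scale[of c f]
  by (simp add: bc_mult_superset[of "Poly_Mapping.keys h" "Poly_Mapping.keys f"]
      bc.scale_sum_right bc_scale_single algebra_simps)

lemma bc_mult_single:
  "Poly_Mapping.single \<mu> a \<star> Poly_Mapping.single \<nu> b = Poly_Mapping.single (nf_mult \<mu> \<nu>) (a * b)"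
  by (simp add: bc_mult_superset[of "{\<mu>}" "{\<nu>}"])

lemma nf_left_commutative: "nf_mult x (nf_mult y z) = nf_mult y (nf_mult x z)"
  by (cases x; cases y; cases z) (simp_all add: ac_simps)

lemma nf_right_commutative: "nf_mult (nf_mult x y) z = nf_mult (nf_mult x z) y"
  by (cases x; cases y; cases z) (simp_all add: ac_simps)

lemma bc_expand:
  "f = (\<Sum>\<mu>\<in>Poly_Mapping.keys f. bc_scale (Poly_Mapping.lookup f \<mu>) (nf \<mu>))"
  by (rule poly_mapping_eqI)
    (auto simp: lookup_sum lookup_single when_def in_keys_iff if_distrib cong: if_cong)

lemma bc_induct [case_names zero add scale nf]:
  assumes "P 0" "\<And>f g. P f \<Longrightarrow> P g \<Longrightarrow> P (f + g)" "\<And>c f. P f \<Longrightarrow> P (bc_scale c f)" "\<And>\<mu>. P (nf \<mu>)"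
  shows "P f"
proof -
  have "P (\<Sum>\<mu>\<in>A. bc_scale (Poly_Mapping.lookup f \<mu>) (nf \<mu>))" if "finite A" for A
    using that by induction (auto intro: assms)
  then show ?thesis using bc_expand[of f] by (metis finite_keys)
qed

lemma bc_zero_mult [simp]: "0 \<star> f = 0" "f \<star> 0 = 0"
  by (simp_all add: bc_mult_def)

lemma bc_left_commutative: "f \<star> (g \<star> h) = g \<star> (f \<star> h)"
proof (induction f rule: bc_induct)
  case (nf \<mu>)
  show ?case
  proof (induction g rule: bc_induct)
    case (nf \<nu>)
    show ?case
      by (induction h rule: bc_induct)
        (simp_all add: bc_mult_add_left bc_mult_add_right bc_mult_scale_left bc_mult_scale_right
          bc_mult_single nf_left_commutative)
  qed (simp_all add: bc_mult_add_left bc_mult_add_right bc_mult_scale_left bc_mult_scale_right)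
qed (simp_all add: bc_mult_add_left bc_mult_add_right bc_mult_scale_left bc_mult_scale_right)

lemma bc_right_commutative: "(f \<star> g) \<star> h = (f \<star> h) \<star> g"
proof (induction f rule: bc_induct)
  case (nf \<mu>)
  show ?case
  proof (induction g rule: bc_induct)
    case (nf \<nu>)
    show ?case
      by (induction h rule: bc_induct)
        (simp_all add: bc_mult_add_left bc_mult_add_right bc_mult_scale_left bc_mult_scale_right
          bc_mult_single nf_right_commutative)
  qed (simp_all add: bc_mult_add_left bc_mult_add_right bc_mult_scale_left bc_mult_scale_right)
qed (simp_all add: bc_mult_add_left bc_mult_add_right bc_mult_scale_left bc_mult_scale_right)

theorem bicommutative_algebra_bc: "bicommutative_algebra bc_scale (\<star>)"
  by unfold_locales
    (rule bc_mult_add_left bc_mult_add_right bc_mult_scale_left bc_mult_scale_right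
      bc_left_commutative bc_right_commutative)+

lemma cword_eqI: "letters u = letters v \<Longrightarrow> u = v"
  by (simp add: letters_inject)

text \<open>$[u;v] = [z_1,\dots,z_{p-1},[z_p,y_1,\dots,y_q]_L]_R$, for any ordering of the letters.\<close>

theorem bc_single_Br:
  assumes "letters u = mset (zs @ [z])" "letters v = mset ys"
  shows "(nf (Br u v) :: ('x, 'k::field) bc) = right_normed zs (left_normed (gen z) ys)"
proof -
  have L: "left_normed (nf (Br w (letter y))) ys' = nf (Br w w')"
    if "letters w' = mset (y # ys')" for w y ys' w'
    using that
  proof (induction ys' arbitrary: w' rule: rev_induct)
    case Nil
    then have "w' = letter y" by (intro cword_eqI) (simp add: letter.rep_eq)
    then show ?case by (simp add: left_normed_def)
  next
    case (snoc a ys')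
    define w2 where "w2 = Abs_cword (mset (y # ys'))"
    have w2: "letters w2 = mset (y # ys')" by (simp add: w2_def Abs_cword_inverse)
    have "w' = w2 + letter a"
      by (intro cword_eqI) (use snoc.prems w2 in \<open>simp add: letter.rep_eq plus_cword.rep_eq\<close>)
    with snoc.IH[OF w2] show ?case by (simp add: left_normed_def bc_mult_single)
  qed
  have "letters v \<noteq> {#}" using letters by blast
  then obtain y ys' where ys: "ys = y # ys'" using assms(2) by (cases ys) auto
  have 1: "left_normed (gen z :: ('x, 'k) bc) ys = nf (Br (letter z) v)"
    using L[of v y ys' "letter z"] assms(2) ys by (simp add: left_normed_def bc_mult_single)
  have "right_normed zs (nf (Br (letter z) v) :: ('x, 'k) bc) = nf (Br u v)"
    using assms(1)
  proof (induction zs arbitrary: u)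
    case Nil
    then have "u = letter z" by (intro cword_eqI) (simp add: letter.rep_eq)
    then show ?case by (simp add: right_normed_def)
  next
    case (Cons a zs)
    define w where "w = Abs_cword (mset (zs @ [z]))"
    have w: "letters w = mset (zs @ [z])" by (simp add: w_def Abs_cword_inverse)
    have "u = letter a + w"
      by (intro cword_eqI) (use Cons.prems w in \<open>simp add: letter.rep_eq plus_cword.rep_eq\<close>)
    with Cons.IH[OF w] show ?case by (simp add: right_normed_def bc_mult_single)
  qed
  with 1 show ?thesis by simp
qed

lemma cword_cases:
  obtains (letter) z where "u = letter z" | (plus) z u' where "u = letter z + u'"
proof -
  obtain z m where zm: "letters u = add_mset z m"
    using letters[of u] by (metis (mono_tags) mem_Collect_eq multiset_cases)
  show thesis
  proof (cases "m = {#}")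
    case True
    with zm have "u = letter z" by (intro cword_eqI) (simp add: letter.rep_eq)
    then show thesis by (rule letter)
  next
    case False
    with zm have "u = letter z + Abs_cword m"
      by (intro cword_eqI) (simp add: letter.rep_eq plus_cword.rep_eq Abs_cword_inverse)
    then show thesis by (rule plus)
  qed
qed

lemma nf_induct [case_names Gen mult]:
  assumes "\<And>x. P (Gen x)" "\<And>\<mu> \<nu>. P \<mu> \<Longrightarrow> P \<nu> \<Longrightarrow> P (nf_mult \<mu> \<nu>)"
  shows "P \<mu>"
proof (induction "nf_length \<mu>" arbitrary: \<mu> rule: less_induct)
  case less
  have pos: "size (letters w) > 0" for w :: "'a cword" using letters[of w] by (simp add: nonempty_has_size)
  show ?case
  proof (cases \<mu>)
    case (Gen x)
    then show ?thesis by (simp add: assms)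
  next
    case (Br u v)
    show ?thesis
    proof (cases u rule: cword_cases)
      case (plus z u')
      with Br have eq: "\<mu> = nf_mult (Gen z) (Br u' v)" by simp
      have "nf_length (Br u' v) < nf_length \<mu>"
        using Br plus by (simp add: plus_cword.rep_eq letter.rep_eq)
      then show ?thesis unfolding eq using eq by (intro assms less) auto
    next
      case u: (letter z)
      show ?thesis
      proof (cases v rule: cword_cases)
        case (letter y)
        with u Br have eq: "\<mu> = nf_mult (Gen z) (Gen y)" by simp
        show ?thesis unfolding eq by (intro assms)
      next
        case (plus y v')
        with Br have eq: "\<mu> = nf_mult (Br u v') (Gen y)" by (simp add: add.commute)
        have "nf_length (Br u v') < nf_length \<mu>"
          using Br plus by (simp add: plus_cword.rep_eq letter.rep_eq)
        then show ?thesis unfolding eq using eq by (intro assms less) auto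
      qed
    qed
  qed
qed

context bicommutative_algebra
begin

lemma LR_commute: "mult (mult z (mult x a)) y = mult z (mult (mult x a) y)"
proof -
  have "mult (mult z (mult x a)) y = mult (mult z y) (mult x a)" by (rule right_commutative)
  also have "\<dots> = mult x (mult (mult z y) a)" by (rule left_commutative)
  also have "\<dots> = mult x (mult (mult z a) y)" by (simp add: right_commutative)
  also have "\<dots> = mult (mult z a) (mult x y)" by (rule left_commutative)
  also have "\<dots> = mult (mult z (mult x y)) a" by (rule right_commutative)
  also have "\<dots> = mult (mult x (mult z y)) a" by (simp add: left_commutative)
  also have "\<dots> = mult (mult x a) (mult z y)" by (rule right_commutative)
  also have "\<dots> = mult z (mult (mult x a) y)" by (rule left_commutative)
  finally show ?thesis .
qed

context
  fixes \<phi> :: "'x \<Rightarrow> 'a"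
begin

definition Lm :: "'x multiset \<Rightarrow> 'a \<Rightarrow> 'a" where
  "Lm u t = fold_mset (\<lambda>z. mult (\<phi> z)) t u"

definition Rm :: "'x multiset \<Rightarrow> 'a \<Rightarrow> 'a" where
  "Rm v t = fold_mset (\<lambda>y a. mult a (\<phi> y)) t v"

interpretation Lf: comp_fun_commute "\<lambda>z. mult (\<phi> z)"
  by unfold_locales (auto simp: left_commutative)

interpretation Rf: comp_fun_commute "\<lambda>y a. mult a (\<phi> y)"
  by unfold_locales (auto simp: right_commutative)

lemma Lm_simps [simp]: "Lm {#} t = t" "Lm (add_mset z u) t = mult (\<phi> z) (Lm u t)"
  by (simp_all add: Lm_def)

lemma Rm_simps [simp]: "Rm {#} t = t" "Rm (add_mset y v) t = mult (Rm v t) (\<phi> y)"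
  by (simp_all add: Rm_def)

lemma Lm_union: "Lm (u + u') t = Lm u (Lm u' t)"
  by (induction u) simp_all

lemma Rm_union: "Rm (v + v') t = Rm v (Rm v' t)"
  by (induction v) simp_all

definition decomposable :: "'a \<Rightarrow> bool" where "decomposable t \<longleftrightarrow> (\<exists>a b. t = mult a b)"

lemma decomposable_mult [simp]: "decomposable (mult a b)"
  by (auto simp: decomposable_def)

lemma decomposable_Rm: "decomposable t \<or> v \<noteq> {#} \<Longrightarrow> decomposable (Rm v t)"
  by (cases v) auto

lemma decomposable_Lm: "decomposable t \<or> u \<noteq> {#} \<Longrightarrow> decomposable (Lm u t)"
  by (cases u) auto

lemma LR1: "decomposable t \<Longrightarrow> mult (mult a t) b = mult a (mult t b)"
  by (auto simp: decomposable_def LR_commute)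

lemma Rm_mult: "decomposable t \<Longrightarrow> Rm v (mult a t) = mult a (Rm v t)"
  by (induction v) (auto simp: LR1 decomposable_Rm)

lemma Rm_Lm: "decomposable t \<Longrightarrow> Rm v (Lm u t) = Lm u (Rm v t)"
  by (induction u) (auto simp: Rm_mult decomposable_Lm)

lemma mult_Lm: "mult a (Lm u t) = Lm u (mult a t)"
  by (induction u) (auto, metis left_commutative)

lemma Rm_mult_left: "Rm v (mult t a) = mult (Rm v t) a"
  by (induction v) (auto, metis right_commutative)

lemma swap_head:
  assumes "v \<noteq> {#}" shows "mult (\<phi> z) (Rm v (\<phi> z')) = mult (\<phi> z') (Rm v (\<phi> z))"
proof -
  from assms obtain y v' where v: "v = v' + {#y#}" by (metis add_mset_add_single multiset_cases)
  have "mult (\<phi> z) (Rm v (\<phi> z')) = Rm v' (mult (\<phi> z) (mult (\<phi> z') (\<phi> y)))" for z z'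
    by (simp only: v Rm_union) (simp add: Rm_mult)
  then show ?thesis by (metis left_commutative)
qed

fun ev :: "'x nf \<Rightarrow> 'a" where
  "ev (Gen x) = \<phi> x"
| "ev (Br u v) = (let z = (SOME z. z \<in># letters u) in Lm (letters u - {#z#}) (Rm (letters v) (\<phi> z)))"

lemma letters_nonempty [simp]: "letters u \<noteq> {#}"
  using letters[of u] by simp

lemma ev_Br:
  assumes "letters u = add_mset z m"
  shows "ev (Br u v) = Lm m (Rm (letters v) (\<phi> z))"
proof -
  define z' where "z' = (SOME z. z \<in># letters u)"
  have "z' \<in># letters u" unfolding z'_def by (rule someI[of _ z]) (simp add: assms)
  then obtain m' where m': "letters u = add_mset z' m'" by (metis multi_member_split)
  have e: "ev (Br u v) = Lm m' (Rm (letters v) (\<phi> z'))"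
    unfolding ev.simps(2) Let_def z'_def[symmetric] by (simp add: m')
  show ?thesis
  proof (cases "z = z'")
    case True
    with assms m' e show ?thesis by simp
  next
    case False
    with assms m' obtain w where "m = add_mset z' w" "m' = add_mset z w"
      by (metis add_eq_conv_ex)
    with e have "ev (Br u v) = Lm w (mult (\<phi> z) (Rm (letters v) (\<phi> z')))"
      by (simp add: mult_Lm del: ev.simps)
    also have "\<dots> = Lm w (mult (\<phi> z') (Rm (letters v) (\<phi> z)))"
      by (simp add: swap_head[of "letters v" z z'])
    finally show ?thesis using \<open>m = add_mset z' w\<close> by (simp add: mult_Lm del: ev.simps)
  qed
qed

lemma Rm_right:
  assumes "decomposable a" "v \<noteq> {#}"
  shows "mult a (Rm v t) = mult t (Rm v a)"
proof -
  from assms obtain y v' where v: "v = v' + {#y#}" by (metis add_mset_add_single multiset_cases)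
  have "mult a (Rm v t) = Rm v' (mult a (mult t (\<phi> y)))"
    by (simp only: v Rm_union) (simp add: Rm_mult)
  also have "\<dots> = Rm v' (mult t (mult a (\<phi> y)))" by (simp add: left_commutative)
  also have "\<dots> = mult t (Rm v a)"
    by (simp only: v Rm_union) (simp add: Rm_mult)
  finally show ?thesis .
qed

lemma ev_mult: "ev (nf_mult \<mu> \<nu>) = mult (ev \<mu>) (ev \<nu>)"
proof -
  have split: "\<exists>z m. letters u = add_mset z m" for u :: "'x cword"
    by (metis letters_nonempty multiset_cases)
  show ?thesis
  proof (cases \<mu>)
    case mu: (Gen z)
    show ?thesis
    proof (cases \<nu>)
      case (Gen y)
      show ?thesis by (simp add: mu Gen ev_Br[of "letter z" z "{#}"] letter.rep_eq del: ev.simps(2))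
    next
      case (Br u v)
      from split obtain a m where u: "letters u = add_mset a m" by blast
      have "letters (letter z + u) = add_mset a (add_mset z m)"
        by (simp add: plus_cword.rep_eq letter.rep_eq u)
      from ev_Br[OF this, of v] ev_Br[OF u, of v] show ?thesis
        by (simp add: mu Br del: ev.simps(2))
    qed
  next
    case mu: (Br u v)
    from split obtain a m where u: "letters u = add_mset a m" by blast
    have D: "decomposable (Rm (letters v) (\<phi> a))" by (simp add: decomposable_Rm)
    show ?thesis
    proof (cases \<nu>)
      case (Gen y)
      show ?thesis
        using Rm_Lm[OF D, of "{#y#}" m]
        by (simp add: mu Gen ev_Br[OF u] plus_cword.rep_eq letter.rep_eq del: ev.simps(2))
    next
      case (Br u' v')
      from split obtain a' m' where u': "letters u' = add_mset a' m'" by blast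
      have uu: "letters (u + u') = add_mset a (add_mset a' (m + m'))"
        by (simp add: plus_cword.rep_eq u u')
      let ?e = "Lm m (Rm (letters v) (\<phi> a))"
      have "mult ?e (Lm m' (Rm (letters v') (\<phi> a'))) = Lm m' (mult ?e (Rm (letters v') (\<phi> a')))"
        by (rule mult_Lm)
      also have "\<dots> = Lm m' (mult (\<phi> a') (Rm (letters v') ?e))"
        by (subst Rm_right) (simp_all add: D decomposable_Lm)
      also have "\<dots> = Lm (add_mset a' m') (Lm m (Rm (letters v') (Rm (letters v) (\<phi> a))))"
        by (simp add: Rm_Lm D flip: mult_Lm)
      also have "\<dots> = Lm (add_mset a' (m + m')) (Rm (letters v + letters v') (\<phi> a))"
        by (simp flip: Lm_union Rm_union add: add.commute)
      finally show ?thesis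
        by (simp add: mu Br ev_Br[OF u] ev_Br[OF u'] ev_Br[OF uu] plus_cword.rep_eq
            del: ev.simps(2) Lm_simps)
    qed
  qed
qed

definition bc_ev :: "('x, 'k) bc \<Rightarrow> 'a" where
  "bc_ev f = (\<Sum>\<mu>\<in>Poly_Mapping.keys f. scale (Poly_Mapping.lookup f \<mu>) (ev \<mu>))"

lemma bc_ev_superset:
  "finite A \<Longrightarrow> Poly_Mapping.keys f \<subseteq> A \<Longrightarrow>
    bc_ev f = (\<Sum>\<mu>\<in>A. scale (Poly_Mapping.lookup f \<mu>) (ev \<mu>))"
  unfolding bc_ev_def by (rule sum.mono_neutral_left) (auto simp: in_keys_iff)

lemma bc_ev_add: "bc_ev (f + g) = bc_ev f + bc_ev g"
  using Poly_Mapping.keys_add[of f g]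
  by (simp add: bc_ev_superset[of "Poly_Mapping.keys f \<union> Poly_Mapping.keys g"] lookup_add
      scale_left_distrib sum.distrib)

lemma bc_ev_scale: "bc_ev (bc_scale c f) = scale c (bc_ev f)"
  using keys_bc_scale[of c f]
  by (simp add: bc_ev_superset[of "Poly_Mapping.keys f"] scale_sum_right)

lemma bc_ev_nf: "bc_ev (nf \<mu>) = ev \<mu>"
  by (simp add: bc_ev_def)

lemma mult_zero: "mult 0 a = 0" "mult a 0 = 0"
  using mult_add_left[of 0 0 a] mult_add_right[of a 0 0] by simp_all

lemma bc_ev_mult: "bc_ev (f \<star> g) = mult (bc_ev f) (bc_ev g)"
proof (induction f rule: bc_induct)
  case zero
  show ?case by (simp add: bc_ev_def mult_zero)
next
  case (nf \<mu>)
  show ?case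
  proof (induction g rule: bc_induct)
    case zero
    show ?case by (simp add: bc_ev_def mult_zero)
  qed (simp_all add: bc_mult_add_right bc_mult_scale_right bc_ev_add bc_ev_scale mult_add_right
      mult_scale_right bc_mult_single bc_ev_nf ev_mult)
qed (simp_all add: bc_mult_add_left bc_mult_scale_left bc_ev_add bc_ev_scale mult_add_left
      mult_scale_left)

end

theorem bc_free:
  fixes \<phi> :: "'x \<Rightarrow> 'a"
  shows "\<exists>!h. Vector_Spaces.linear bc_scale scale h \<and>
    (\<forall>f g. h (f \<star> g) = mult (h f) (h g)) \<and> (\<forall>x. h (gen x) = \<phi> x)"
proof (rule ex1I[of _ "bc_ev \<phi>"])
  have "Vector_Spaces.linear bc_scale scale (bc_ev \<phi>)"
    by unfold_locales (simp_all add: bc_ev_add bc_ev_scale)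
  then show "Vector_Spaces.linear bc_scale scale (bc_ev \<phi>) \<and>
    (\<forall>f g. bc_ev \<phi> (f \<star> g) = mult (bc_ev \<phi> f) (bc_ev \<phi> g)) \<and> (\<forall>x. bc_ev \<phi> (gen x) = \<phi> x)"
    by (simp add: bc_ev_mult bc_ev_nf)
next
  fix h assume h: "Vector_Spaces.linear bc_scale scale h \<and>
    (\<forall>f g. h (f \<star> g) = mult (h f) (h g)) \<and> (\<forall>x. h (gen x) = \<phi> x)"
  interpret h: Vector_Spaces.linear bc_scale scale h using h by blast
  have nf: "h (nf \<mu>) = bc_ev \<phi> (nf \<mu>)" for \<mu>
  proof (induction \<mu> rule: nf_induct)
    case (Gen x)
    then show ?case using h by (simp add: bc_ev_nf)
  next
    case (mult \<mu> \<nu>)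
    have "h (nf (nf_mult \<mu> \<nu>)) = h (nf \<mu> \<star> nf \<nu>)" by (simp add: bc_mult_single)
    also have "\<dots> = mult (h (nf \<mu>)) (h (nf \<nu>))" using h by blast
    finally show ?case by (simp add: mult bc_ev_nf ev_mult)
  qed
  show "h = bc_ev \<phi>"
  proof
    show "h f = bc_ev \<phi> f" for f
    proof (induction f rule: bc_induct)
      case zero
      show ?case by (simp add: h.zero bc_ev_def)
    qed (simp_all add: h.add h.scale bc_ev_add bc_ev_scale nf)
  qed
qed

end


section \<open>Monomial orders and leading monomials\<close>

text \<open>A well order is given by its strict part.\<close>

definition monomial_order :: "('x nf \<Rightarrow> 'x nf \<Rightarrow> bool) \<Rightarrow> bool" where
  "monomial_order lt \<longleftrightarrow> transp lt \<and> totalp lt \<and> wfp lt \<and>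
     (\<forall>\<mu> \<nu> \<nu>'. lt \<mu> \<nu> \<longrightarrow> lt (nf_mult \<mu> \<nu>') (nf_mult \<nu> \<nu>') \<and> lt (nf_mult \<nu>' \<mu>) (nf_mult \<nu>' \<nu>))"

text \<open>The leading monomial is meaningful only for nonzero arguments.\<close>

definition lead :: "('x nf \<Rightarrow> 'x nf \<Rightarrow> bool) \<Rightarrow> ('x, 'k::field) bc \<Rightarrow> 'x nf" where
  "lead lt f = (THE \<mu>. \<mu> \<in> Poly_Mapping.keys f \<and> (\<forall>\<nu>\<in>Poly_Mapping.keys f. \<nu> = \<mu> \<or> lt \<nu> \<mu>))"

definition monic_set :: "('x nf \<Rightarrow> 'x nf \<Rightarrow> bool) \<Rightarrow> ('x, 'k::field) bc set \<Rightarrow> bool" where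
  "monic_set lt S \<longleftrightarrow> (\<forall>s\<in>S. s \<noteq> 0 \<and> Poly_Mapping.lookup s (lead lt s) = 1)"


section \<open>Ideals and quotients\<close>

definition bc_ideal :: "('x, 'k::field) bc set \<Rightarrow> bool" where
  "bc_ideal I \<longleftrightarrow> bc.subspace I \<and> (\<forall>f\<in>I. \<forall>g. g \<star> f \<in> I \<and> f \<star> g \<in> I)"

definition bc_Id :: "('x, 'k::field) bc set \<Rightarrow> ('x, 'k) bc set" where
  "bc_Id S = bc_ideal hull S"

text \<open>
  The vector space $\mathrm{BC}(X)/I$, whose elements are the residue classes modulo $I$. Its
  multiplication plays no role for the notion of a linear basis.
\<close>

definition congruence :: "('x, 'k::field) bc set \<Rightarrow> (('x, 'k) bc \<times> ('x, 'k) bc) set" where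
  "congruence I = {(f, g). f - g \<in> I}"

definition residue :: "('x, 'k::field) bc set \<Rightarrow> ('x, 'k) bc \<Rightarrow> ('x, 'k) bc set" where
  "residue I f = congruence I `` {f}"

definition quot_carrier :: "('x, 'k::field) bc set \<Rightarrow> ('x, 'k) bc set set" where
  "quot_carrier I = UNIV // congruence I"

definition quot_add ::
  "('x, 'k::field) bc set \<Rightarrow> ('x, 'k) bc set \<Rightarrow> ('x, 'k) bc set \<Rightarrow> ('x, 'k) bc set" where
  "quot_add I A B = (\<Union>f\<in>A. \<Union>g\<in>B. residue I (f + g))"

definition quot_scale ::
  "('x, 'k::field) bc set \<Rightarrow> 'k \<Rightarrow> ('x, 'k) bc set \<Rightarrow> ('x, 'k) bc set" where
  "quot_scale I c A = (\<Union>f\<in>A. residue I (bc_scale c f))"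

definition quot_subspace :: "('x, 'k::field) bc set \<Rightarrow> ('x, 'k) bc set set \<Rightarrow> bool" where
  "quot_subspace I W \<longleftrightarrow> W \<subseteq> quot_carrier I \<and> residue I 0 \<in> W \<and>
     (\<forall>A\<in>W. \<forall>B\<in>W. quot_add I A B \<in> W) \<and> (\<forall>c. \<forall>A\<in>W. quot_scale I c A \<in> W)"

definition quot_span :: "('x, 'k::field) bc set \<Rightarrow> ('x, 'k) bc set set \<Rightarrow> ('x, 'k) bc set set" where
  "quot_span I T = quot_subspace I hull T"

definition quot_basis :: "('x, 'k::field) bc set \<Rightarrow> ('x, 'k) bc set set \<Rightarrow> bool" where
  "quot_basis I T \<longleftrightarrow> T \<subseteq> quot_carrier I \<and>
     (\<forall>A\<in>T. A \<notin> quot_span I (T - {A})) \<and> quot_span I T = quot_carrier I"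

text \<open>A set of normal forms is a linear basis of the quotient as a family: its elements have
  pairwise different residue classes, and these classes form a basis.\<close>

definition forms_quot_basis :: "('x, 'k::field) bc set \<Rightarrow> 'x nf set \<Rightarrow> bool" where
  "forms_quot_basis I B \<longleftrightarrow>
     inj_on (\<lambda>\<mu>. residue I (nf \<mu>)) B \<and> quot_basis I ((\<lambda>\<mu>. residue I (nf \<mu>)) ` B)"

lemma residue_eq_iff:
  assumes "bc.subspace I" shows "residue I f = residue I g \<longleftrightarrow> f - g \<in> I"
proof -
  have "g - f \<in> I \<longleftrightarrow> f - g \<in> I" for f g
    using bc.subspace_neg[OF assms, of "g - f"] bc.subspace_neg[OF assms, of "f - g"] by auto
  moreover have "f - h \<in> I" if "f - g \<in> I" "g - h \<in> I" for f g h
    using bc.subspace_add[OF assms that] by simp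
  ultimately show ?thesis
    unfolding residue_def congruence_def using bc.subspace_0[OF assms]
    by (auto simp: set_eq_iff)
qed

lemma quot_add_residue:
  assumes "bc.subspace I" shows "quot_add I (residue I f) (residue I g) = residue I (f + g)"
proof -
  have "residue I (f' + g') = residue I (f + g)" if "f - f' \<in> I" "g - g' \<in> I" for f' g'
    using bc.subspace_neg[OF assms bc.subspace_add[OF assms that]]
    by (simp add: residue_eq_iff[OF assms] algebra_simps)
  then have "residue I (f' + g') = residue I (f + g)" if "f' \<in> residue I f" "g' \<in> residue I g" for f' g'
    using that by (auto simp: residue_def congruence_def)
  moreover have "f \<in> residue I f" "g \<in> residue I g"
    using bc.subspace_0[OF assms] by (simp_all add: residue_def congruence_def)
  ultimately show ?thesis unfolding quot_add_def by blast
qed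

lemma quot_scale_residue:
  assumes "bc.subspace I" shows "quot_scale I c (residue I f) = residue I (bc_scale c f)"
proof -
  have "residue I (bc_scale c f') = residue I (bc_scale c f)" if "f - f' \<in> I" for f'
    using bc.subspace_neg[OF assms bc.subspace_scale[OF assms that, of c]]
    by (simp add: residue_eq_iff[OF assms] bc.scale_right_diff_distrib)
  then have "residue I (bc_scale c f') = residue I (bc_scale c f)" if "f' \<in> residue I f" for f'
    using that by (auto simp: residue_def congruence_def)
  moreover have "f \<in> residue I f"
    using bc.subspace_0[OF assms] by (simp add: residue_def congruence_def)
  ultimately show ?thesis unfolding quot_scale_def by blast
qed


section \<open>Normal $S$-polynomials and Groebner--Shirshov bases\<close>

inductive_set normal_spolys ::
  "('x nf \<Rightarrow> 'x nf \<Rightarrow> bool) \<Rightarrow> ('x, 'k::field) bc set \<Rightarrow> ('x, 'k) bc set"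
  for lt S where
  self: "s \<in> S \<Longrightarrow> s \<in> normal_spolys lt S"
| extend: "s \<in> S \<Longrightarrow> nf_length (lead lt s) \<ge> 2 \<Longrightarrow>
    right_normed zs (left_normed s ys) \<in> normal_spolys lt S"

definition GS_basis ::
  "('x nf \<Rightarrow> 'x nf \<Rightarrow> bool) \<Rightarrow> ('x, 'k::field) bc set \<Rightarrow> ('x, 'k) bc set \<Rightarrow> bool" where
  "GS_basis lt S I \<longleftrightarrow> monic_set lt S \<and> bc_Id S = I \<and>
     (\<forall>f\<in>I. f \<noteq> 0 \<longrightarrow> (\<exists>h\<in>normal_spolys lt S. lead lt f = lead lt h))"

definition Irr :: "('x nf \<Rightarrow> 'x nf \<Rightarrow> bool) \<Rightarrow> ('x, 'k::field) bc set \<Rightarrow> 'x nf set" where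
  "Irr lt S = UNIV - {\<mu>. \<exists>h\<in>normal_spolys lt S. \<mu> = lead lt h}"


section \<open>Compositions\<close>

text \<open>Left and right multiplication compositions; these come without a reference monomial.\<close>

inductive_set mult_compositions ::
  "('x nf \<Rightarrow> 'x nf \<Rightarrow> bool) \<Rightarrow> ('x, 'k::field) bc set \<Rightarrow> ('x, 'k) bc set"
  for lt S where
  left: "f \<in> S \<Longrightarrow> nf_length (lead lt f) = 1 \<Longrightarrow> gen z \<star> f \<in> mult_compositions lt S"
| right: "f \<in> S \<Longrightarrow> nf_length (lead lt f) = 1 \<Longrightarrow> f \<star> gen z \<in> mult_compositions lt S"

text \<open>The other compositions, as pairs consisting of $(f,g)_\mu$ and $\mu$.\<close>

inductive_set compositions ::
  "('x nf \<Rightarrow> 'x nf \<Rightarrow> bool) \<Rightarrow> ('x, 'k::field) bc set \<Rightarrow> (('x, 'k) bc \<times> 'x nf) set"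
  for lt S where
  inclusion: "f \<in> S \<Longrightarrow> g \<in> S \<Longrightarrow> lead lt f = lead lt g \<Longrightarrow> lead lt f \<in> range Gen \<Longrightarrow>
    (f - g, lead lt f) \<in> compositions lt S"
| multiplication: "f \<in> S \<Longrightarrow> nf_length (lead lt f) \<ge> 2 \<Longrightarrow>
    f \<notin> bc.span (nf ` (UNIV - range Gen)) \<Longrightarrow>
    (gen y \<star> (f \<star> gen z) - (gen y \<star> f) \<star> gen z, lead lt (gen y \<star> (f \<star> gen z)))
      \<in> compositions lt S"
| intersection: "f \<in> S \<Longrightarrow> g \<in> S \<Longrightarrow> lead lt f = Br u v \<Longrightarrow> lead lt g = Br u' v' \<Longrightarrow>
    \<mu> = Br (cword_lcm u u') (cword_lcm v v') \<Longrightarrow>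
    nf_length \<mu> < nf_length (lead lt f) + nf_length (lead lt g) \<Longrightarrow>
    letters (cword_lcm u u') = letters u + mset a \<Longrightarrow>
    letters (cword_lcm u u') = letters u' + mset b \<Longrightarrow>
    letters (cword_lcm v v') = letters v + mset c \<Longrightarrow>
    letters (cword_lcm v v') = letters v' + mset d \<Longrightarrow>
    (right_normed a (left_normed f c) - right_normed b (left_normed g d), \<mu>)
      \<in> compositions lt S"

text \<open>The zero polynomial lies in every span, so it counts as trivial whatever \<open>lead lt 0\<close> is.\<close>

definition all_compositions_trivial ::
  "('x nf \<Rightarrow> 'x nf \<Rightarrow> bool) \<Rightarrow> ('x, 'k::field) bc set \<Rightarrow> bool" where
  "all_compositions_trivial lt S \<longleftrightarrow>
     (\<forall>h\<in>mult_compositions lt S.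
        h \<in> bc.span {p \<in> normal_spolys lt S. lead lt p = lead lt h \<or> lt (lead lt p) (lead lt h)}) \<and>
     (\<forall>(h, \<mu>)\<in>compositions lt S.
        h \<in> bc.span {p \<in> normal_spolys lt S. lt (lead lt p) \<mu>})"

end

theory Submission
  imports Defs
begin

text \<open>
  On $\mathrm{BC}(X)^2$ the left multiplications and the right multiplications by generators form one
  commuting family. Hence, up to normal $S$-polynomials with smaller leading monomials (multiplication
  compositions), a normal $S$-polynomial is determined by $s$ and the multisets of letters applied on
  the two sides. Triviality of the compositions thus makes the span of the normal $S$-polynomials an
  ideal, and makes two normal $S$-polynomials with the same leading monomial differ by smaller ones:
  factor the difference through the least common multiple, and if that has maximal length, compare
  both terms with the product $fg$. A well-founded descent on the leading monomial then gives (ii).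
  The equivalence with (iii) is reduction modulo normal $S$-polynomials.
\<close>

section \<open>The free bicommutative algebra\<close>

lemma keys_sum_subset:
  "(\<And>i. i \<in> A \<Longrightarrow> Poly_Mapping.keys (F i) \<subseteq> B) \<Longrightarrow> Poly_Mapping.keys (sum F A) \<subseteq> B"
  by (rule order.trans[OF Poly_Mapping.keys_sum UN_least])

lemma bc_diff_mult: "(f - g) \<star> h = f \<star> h - g \<star> h"
  by (metis add_diff_cancel bc_mult_add_left diff_add_cancel)

lemma bc_mult_diff: "h \<star> (f - g) = h \<star> f - h \<star> g"
  by (metis add_diff_cancel bc_mult_add_right diff_add_cancel)

lemma keys_bc_mult:
  "Poly_Mapping.keys (f \<star> g) \<subseteq> (\<lambda>(\<mu>, \<nu>). nf_mult \<mu> \<nu>) ` (Poly_Mapping.keys f \<times> Poly_Mapping.keys g)"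
  unfolding bc_mult_def by (intro keys_sum_subset) (auto split: if_splits)

lemma subspace_supported: "bc.subspace {f :: ('x, 'k::field) bc. Poly_Mapping.keys f \<subseteq> B}"
proof -
  have "Poly_Mapping.keys (f + g) \<subseteq> B"
    if "Poly_Mapping.keys f \<subseteq> B" "Poly_Mapping.keys g \<subseteq> B" for f g :: "('x, 'k) bc"
    using Poly_Mapping.keys_add[of f g] that by blast
  moreover have "Poly_Mapping.keys (bc_scale c f) \<subseteq> B"
    if "Poly_Mapping.keys f \<subseteq> B" for c and f :: "('x, 'k) bc"
    using keys_bc_scale[of c f] that by blast
  ultimately show ?thesis by (auto simp: bc.subspace_def)
qed

text \<open>Turns membership in a span of normal forms into a condition on the support;
  \<open>bc_square\<close>, \<open>lower\<close> and the spans in the quotient are handled this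
  way.\<close>

lemma span_nf:
  fixes B :: "'x nf set"
  shows "bc.span (nf ` B :: ('x, 'k::field) bc set) = {f. Poly_Mapping.keys f \<subseteq> B}"
    (is "?L = ?R")
proof
  show "?L \<subseteq> ?R"
    by (rule bc.span_minimal[OF _ subspace_supported]) auto
  show "?R \<subseteq> ?L"
  proof
    fix f assume "f \<in> ?R"
    then have "(\<Sum>\<mu>\<in>Poly_Mapping.keys f. bc_scale (Poly_Mapping.lookup f \<mu>) (nf \<mu>)) \<in> bc.span (nf ` B)"
      by (intro bc.span_sum bc.span_scale bc.span_base) auto
    then show "f \<in> ?L" by (simp only: bc_expand[symmetric])
  qed
qed

text \<open>The span of all products, written as in the premise of the multiplication composition,
  so that failing to lie in it makes that composition available.\<close>

abbreviation bc_square :: "('x, 'k::field) bc set" where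
  "bc_square \<equiv> bc.span (nf ` (UNIV - range Gen))"

lemma nf_mult_not_Gen: "nf_mult \<mu> \<nu> \<noteq> Gen x"
  by (cases \<mu>; cases \<nu>) auto

lemma bc_mult_in_square: "f \<star> g \<in> bc_square"
proof -
  have "(\<lambda>(\<mu>, \<nu>). nf_mult \<mu> \<nu>) ` A \<subseteq> UNIV - range Gen" for A :: "('a nf \<times> 'a nf) set"
    by (auto simp: nf_mult_not_Gen)
  from order.trans[OF keys_bc_mult this] show ?thesis unfolding span_nf by (rule CollectI)
qed

text \<open>On \<open>nf (Br u v)\<close> a left factor only changes \<open>u\<close> and a right
  factor only changes \<open>v\<close>. For a generator \<open>x\<close> in place of
  \<open>f\<close> this fails in general: \<open>y(xz)\<close> is \<open>[yx;z]\<close>, but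
  \<open>(yx)z\<close> is \<open>[y;xz]\<close>.\<close>

lemma square_LR_commute:
  assumes "f \<in> bc_square"
  shows "gen y \<star> (f \<star> gen z) = (gen y \<star> f) \<star> gen z"
  using assms
proof (induction rule: bc.span_induct_alt)
  case (step c g f)
  then obtain \<mu> where "g = nf \<mu>" "\<mu> \<notin> range Gen" by blast
  moreover from this obtain u v where "\<mu> = Br u v" by (cases \<mu>) auto
  ultimately have "g = nf (Br u v)" by simp
  with step show ?case
    by (simp add: bc_mult_add_left bc_mult_add_right bc_mult_scale_left bc_mult_scale_right
        bc_mult_single)
qed simp

section \<open>Products with several generators\<close>

lemma left_normed_simps [simp]:
  "left_normed f [] = f" "left_normed f (ys @ zs) = left_normed (left_normed f ys) zs"
  "left_normed f [y] = f \<star> gen y"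
  by (simp_all add: left_normed_def)

lemma right_normed_simps [simp]:
  "right_normed [] f = f" "right_normed (ys @ zs) f = right_normed ys (right_normed zs f)"
  "right_normed (y # ys) f = gen y \<star> right_normed ys f"
  by (simp_all add: right_normed_def)

lemma left_normed_Cons: "left_normed f (y # ys) = left_normed (f \<star> gen y) ys"
  by (simp add: left_normed_def)

lemma left_normed_add: "left_normed (f + g) ys = left_normed f ys + left_normed g ys"
  by (induction ys rule: rev_induct) (simp_all add: bc_mult_add_left)

lemma left_normed_scale: "left_normed (bc_scale c f) ys = bc_scale c (left_normed f ys)"
  by (induction ys rule: rev_induct) (simp_all add: bc_mult_scale_left)

lemma left_normed_zero [simp]: "left_normed 0 ys = 0"
  by (induction ys rule: rev_induct) simp_all

lemma left_normed_diff: "left_normed (f - g) ys = left_normed f ys - left_normed g ys"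
  by (metis add_diff_cancel diff_add_cancel left_normed_add)

lemma right_normed_add: "right_normed ys (f + g) = right_normed ys f + right_normed ys g"
  by (induction ys) (simp_all add: bc_mult_add_right)

lemma right_normed_scale: "right_normed ys (bc_scale c f) = bc_scale c (right_normed ys f)"
  by (induction ys) (simp_all add: bc_mult_scale_right)

lemma right_normed_zero [simp]: "right_normed ys 0 = 0"
  by (induction ys) simp_all

lemma right_normed_diff: "right_normed ys (f - g) = right_normed ys f - right_normed ys g"
  by (metis add_diff_cancel diff_add_cancel right_normed_add)

lemma right_normed_mult: "right_normed ys (g \<star> f) = g \<star> right_normed ys f"
  by (induction ys) (simp_all add: bc_left_commutative)

lemma left_normed_mult: "left_normed (f \<star> g) ys = left_normed f ys \<star> g"
  by (induction ys rule: rev_induct) (simp_all add: bc_right_commutative)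

text \<open>Left multiplications commute with each other, so the head of one list can be pulled out
  of the middle of the other.\<close>

lemma right_normed_cong:
  assumes "mset ys = mset zs" shows "right_normed ys f = right_normed zs f"
  using assms
proof (induction ys arbitrary: zs)
  case (Cons y ys)
  then obtain as bs where zs: "zs = as @ y # bs"
    by (metis list.set_intros(1) set_mset_mset split_list)
  with Cons.prems have "mset ys = mset (as @ bs)" by simp
  from Cons.IH[OF this] show ?case by (simp add: zs right_normed_mult)
qed simp

lemma left_normed_cong:
  assumes "mset ys = mset zs" shows "left_normed f ys = left_normed f zs"
  using assms
proof (induction ys arbitrary: zs)
  case (Cons y ys)
  then obtain as bs where zs: "zs = as @ y # bs"
    by (metis list.set_intros(1) set_mset_mset split_list)
  with Cons.prems have "mset ys = mset (as @ bs)" by simp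
  from Cons.IH[OF this] show ?case by (simp add: zs left_normed_Cons left_normed_mult)
qed simp

section \<open>Words extended by letters, and multiplication by normal forms\<close>

text \<open>The added multiset may be empty, unlike a second word: this records the effect of a
  possibly empty list of multipliers on one side of a normal form.\<close>

lift_definition cword_extend :: "'x cword \<Rightarrow> 'x multiset \<Rightarrow> 'x cword" is "(+)" by simp

lemma letters_plus [simp]: "letters (u + v) = letters u + letters v"
  by (simp add: plus_cword.rep_eq)

lemma letters_letter [simp]: "letters (letter x) = {#x#}"
  by (simp add: letter.rep_eq)

lemma letters_extend [simp]: "letters (cword_extend u m) = letters u + m"
  by (simp add: cword_extend.rep_eq)

lemma letters_lcm [simp]: "letters (cword_lcm u v) = letters u \<union># letters v"
  by (simp add: cword_lcm.rep_eq)

lemma letters_ne [simp]: "letters u \<noteq> {#}"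
  using letters[of u] by simp

lemma extend_extend [simp]: "cword_extend (cword_extend u m) n = cword_extend u (m + n)"
  by (intro cword_eqI) (simp add: ac_simps)

lemma extend_empty [simp]: "cword_extend u {#} = u"
  by (intro cword_eqI) simp

lemma letter_plus_extend [simp]: "letter z + cword_extend u m = cword_extend u (add_mset z m)"
  "cword_extend u m + letter z = cword_extend u (add_mset z m)"
  by (intro cword_eqI; simp)+

lemma letter_plus: "letter z + u = cword_extend u {#z#}" "u + letter z = cword_extend u {#z#}"
  by (intro cword_eqI; simp)+

lemma left_normed_nf_Br: "left_normed (nf (Br u v)) ys = nf (Br u (cword_extend v (mset ys)))"
  by (induction ys rule: rev_induct) (simp_all add: bc_mult_single)

lemma right_normed_nf_Br: "right_normed ys (nf (Br u v)) = nf (Br (cword_extend u (mset ys)) v)"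
  by (induction ys) (simp_all add: bc_mult_single)

lemma left_normed_gen:
  "mset ys = letters v \<Longrightarrow> (left_normed (gen x) ys :: ('x, 'k::field) bc) = nf (Br (letter x) v)"
  using bc_single_Br[of "letter x" "[]" x v ys, where 'k = 'k] by simp

lemma right_normed_gen:
  assumes "mset ys = letters u"
  shows "(right_normed ys (gen x) :: ('x, 'k::field) bc) = nf (Br u (letter x))"
proof -
  \<comment> \<open>\<open>bc_single_Br\<close> needs the last letter of the left word separately,
    as the factor to which the right letter \<open>x\<close> is applied.\<close>
  have "ys \<noteq> []" using assms by auto
  then obtain zs w where "ys = zs @ [w]" by (metis append_butlast_last_id)
  then show ?thesis
    using bc_single_Br[of u zs w "letter x" "[x]", where 'k = 'k] assms by simp
qed

text \<open>Linear in \<open>f\<close>, hence checked on normal forms. The nesting matters for a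
  generator \<open>f\<close>: here the right factors must act first, in \<open>nf_Br_mult\<close>
  the left ones.\<close>

lemma mult_nf_Br:
  assumes "mset zs = letters u" "mset ys = letters v"
  shows "f \<star> nf (Br u v) = right_normed zs (left_normed f ys)"
proof (induction f rule: bc_induct)
  case (nf \<mu>)
  show ?case
  proof (cases \<mu>)
    case (Gen x)
    have "letter x + u = cword_extend (letter x) (letters u)" by (intro cword_eqI) simp
    then show ?thesis
      by (simp add: Gen left_normed_gen assms right_normed_nf_Br bc_mult_single)
  next
    case (Br u' v')
    have "u' + u = cword_extend u' (letters u)" "v' + v = cword_extend v' (letters v)"
      by (intro cword_eqI; simp)+
    then show ?thesis
      by (simp add: Br left_normed_nf_Br right_normed_nf_Br assms bc_mult_single)
  qed
qed (simp_all add: bc_mult_add_left bc_mult_scale_left left_normed_add left_normed_scale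
    right_normed_add right_normed_scale)

lemma nf_Br_mult:
  assumes "mset zs = letters u" "mset ys = letters v"
  shows "nf (Br u v) \<star> f = left_normed (right_normed zs f) ys"
proof (induction f rule: bc_induct)
  case (nf \<mu>)
  show ?case
  proof (cases \<mu>)
    case (Gen x)
    have "v + letter x = cword_extend (letter x) (letters v)" by (intro cword_eqI) simp
    then show ?thesis
      by (simp add: Gen right_normed_gen assms left_normed_nf_Br bc_mult_single)
  next
    case (Br u' v')
    have "u + u' = cword_extend u' (letters u)" "v + v' = cword_extend v' (letters v)"
      by (intro cword_eqI; simp)+
    then show ?thesis
      by (simp add: Br left_normed_nf_Br right_normed_nf_Br assms bc_mult_single)
  qed
qed (simp_all add: bc_mult_add_right bc_mult_scale_right left_normed_add left_normed_scale
    right_normed_add right_normed_scale)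

lemma nf_length_Br: "nf_length (Br u v) \<ge> 2"
proof -
  have "size (letters w) > 0" for w :: "'a cword" using letters_ne[of w] nonempty_has_size by blast
  from this[of u] this[of v] show ?thesis by simp
qed

lemma nf_length_ge_2: "nf_length \<mu> \<ge> 2 \<longleftrightarrow> (\<exists>u v. \<mu> = Br u v)"
  using nf_length_Br by (cases \<mu>) auto

section \<open>Ideals and quotients\<close>

lemma bc_ideal_Id: "bc_ideal (bc_Id S)"
  unfolding bc_Id_def
  by (rule hull_in) (auto simp: bc_ideal_def bc.subspace_def)

lemma subspace_Id: "bc.subspace (bc_Id S)"
  using bc_ideal_Id by (auto simp: bc_ideal_def)

lemma Id_mult: "f \<in> bc_Id S \<Longrightarrow> g \<star> f \<in> bc_Id S" "f \<in> bc_Id S \<Longrightarrow> f \<star> g \<in> bc_Id S"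
  using bc_ideal_Id by (auto simp: bc_ideal_def)

lemma Id_inc: "f \<in> S \<Longrightarrow> f \<in> bc_Id S"
  unfolding bc_Id_def by (rule hull_inc)

lemma Id_right_normed: "f \<in> bc_Id S \<Longrightarrow> right_normed zs f \<in> bc_Id S"
  by (induction zs) (simp_all add: Id_mult)

lemma Id_left_normed: "f \<in> bc_Id S \<Longrightarrow> left_normed f zs \<in> bc_Id S"
  by (induction zs rule: rev_induct) (simp_all add: Id_mult)

lemma normal_spolys_in_Id: "normal_spolys lt S \<subseteq> bc_Id S"
  by (auto elim!: normal_spolys.cases intro: Id_right_normed Id_left_normed Id_inc)

text \<open>Bicommutativity turns a product with \<open>nf_mult \<mu> \<nu>\<close> into a left
  product with \<open>\<mu>\<close> and a right product with \<open>\<nu>\<close>, so induction over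
  normal forms leaves only generators.\<close>

lemma bc_ideal_if_mult_gens:
  fixes V :: "('x, 'k::field) bc set"
  assumes V: "bc.subspace V"
    and gen: "\<And>f z. f \<in> V \<Longrightarrow> gen z \<star> f \<in> V" "\<And>f z. f \<in> V \<Longrightarrow> f \<star> gen z \<in> V"
  shows "bc_ideal V"
proof -
  have single: "\<forall>f\<in>V. nf \<mu> \<star> f \<in> V \<and> f \<star> nf \<mu> \<in> V" for \<mu>
  proof (induction \<mu> rule: nf_induct)
    case (mult \<mu> \<nu>)
    have "nf (nf_mult \<mu> \<nu>) \<star> f = (nf \<mu> \<star> f) \<star> nf \<nu>"
      "f \<star> nf (nf_mult \<mu> \<nu>) = nf \<mu> \<star> (f \<star> nf \<nu>)" for f :: "('x, 'k) bc"
      by (metis bc_mult_single bc_right_commutative mult_1)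
        (metis bc_mult_single bc_left_commutative mult_1)
    with mult show ?case by metis
  qed (use gen in blast)
  have "g \<star> f \<in> V \<and> f \<star> g \<in> V" if f: "f \<in> V" for f g
  proof (induction g rule: bc_induct)
    case (nf \<mu>)
    with single f show ?case by blast
  qed (use V f in \<open>auto simp: bc_mult_add_left bc_mult_add_right bc_mult_scale_left
      bc_mult_scale_right bc.subspace_def\<close>)
  with V show ?thesis unfolding bc_ideal_def by blast
qed

section \<open>Linear bases of the quotient\<close>

text \<open>The image of \<open>bc.span F\<close> is a subspace of the quotient containing the
  classes of \<open>F\<close>, and every such subspace contains it by induction on the span.\<close>

lemma quot_span_residue:
  assumes I: "bc.subspace I"
  shows "quot_span I (residue I ` F) = residue I ` bc.span F"
proof
  have "quot_subspace I (residue I ` bc.span F)"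
    unfolding quot_subspace_def
  proof (intro conjI ballI allI)
    show "residue I ` bc.span F \<subseteq> quot_carrier I"
      by (auto simp: quot_carrier_def residue_def intro: quotientI)
  qed (auto simp: quot_add_residue[OF I] quot_scale_residue[OF I]
      intro: imageI bc.span_zero bc.span_add bc.span_scale)
  moreover have "residue I ` F \<subseteq> residue I ` bc.span F"
    by (intro image_mono bc.span_superset)
  ultimately show "quot_span I (residue I ` F) \<subseteq> residue I ` bc.span F"
    unfolding quot_span_def by (intro hull_minimal)
  have "residue I f \<in> W" if W: "quot_subspace I W" "residue I ` F \<subseteq> W" and f: "f \<in> bc.span F" for W f
    using f
  proof (induction rule: bc.span_induct_alt)
    case base
    show ?case using W by (simp add: quot_subspace_def)
  next
    case (step c g f)
    have "residue I (bc_scale c g + f) = quot_add I (quot_scale I c (residue I g)) (residue I f)"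
      by (simp add: quot_add_residue[OF I] quot_scale_residue[OF I])
    with step W show ?case unfolding quot_subspace_def by auto
  qed
  then show "residue I ` bc.span F \<subseteq> quot_span I (residue I ` F)"
    unfolding quot_span_def hull_def by blast
qed

text \<open>A linear relation among the classes of \<open>B\<close> is an element of
  \<open>I\<close> supported on \<open>B\<close>; a failure of injectivity is the relation
  \<open>nf \<mu> - nf \<nu>\<close>.\<close>

lemma forms_quot_basis_iff:
  fixes I :: "('x, 'k::field) bc set"
  assumes I: "bc.subspace I"
  shows "forms_quot_basis I B \<longleftrightarrow>
    (\<forall>r\<in>I. Poly_Mapping.keys r \<subseteq> B \<longrightarrow> r = 0) \<and> (\<forall>f. \<exists>r. Poly_Mapping.keys r \<subseteq> B \<and> f - r \<in> I)"
    (is "_ \<longleftrightarrow> ?ind \<and> ?gen")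
proof -
  let ?R = "\<lambda>\<mu>. residue I (nf \<mu> :: ('x, 'k) bc)"
  have R: "\<And>f g. residue I f = residue I g \<longleftrightarrow> f - g \<in> I" by (rule residue_eq_iff[OF I])
  have span: "quot_span I (?R ` C) = residue I ` {r. Poly_Mapping.keys r \<subseteq> C}" for C
    using quot_span_residue[OF I, of "nf ` C"] by (simp add: span_nf image_image)
  have carrier: "quot_carrier I = range (residue I)"
    by (auto simp: quot_carrier_def quotient_def residue_def)
  have gen: "quot_span I (?R ` B) = quot_carrier I \<longleftrightarrow> ?gen"
  proof -
    have "quot_span I (?R ` B) = quot_carrier I \<longleftrightarrow> (\<forall>f. residue I f \<in> residue I ` {r. Poly_Mapping.keys r \<subseteq> B})"
      unfolding span carrier by blast
    also have "\<dots> \<longleftrightarrow> ?gen" by (auto simp: image_iff R)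
    finally show ?thesis .
  qed
  have ind: "inj_on ?R B \<and> (\<forall>A\<in>?R ` B. A \<notin> quot_span I (?R ` B - {A})) \<longleftrightarrow> ?ind"
  proof (intro iffI conjI ballI impI)
    fix r assume *: "inj_on ?R B \<and> (\<forall>A\<in>?R ` B. A \<notin> quot_span I (?R ` B - {A}))"
      and r: "r \<in> I" "Poly_Mapping.keys r \<subseteq> B"
    show "r = 0"
    proof (rule ccontr)
      assume "r \<noteq> 0"
      then obtain \<mu> where \<mu>: "\<mu> \<in> Poly_Mapping.keys r" by (metis all_not_in_conv keys_eq_empty)
      let ?c = "inverse (Poly_Mapping.lookup r \<mu>)"
      \<comment> \<open>Scaling \<open>r\<close> to coefficient 1 at \<open>\<mu>\<close> solves the
        relation for \<open>\<mu>\<close>: \<open>?q\<close> avoids \<open>\<mu>\<close> and lies in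
        its class.\<close>
      let ?q = "nf \<mu> - bc_scale ?c r"
      from \<mu> r have \<mu>B: "\<mu> \<in> B" by auto
      have "Poly_Mapping.keys ?q \<subseteq> B - {\<mu>}"
        using r \<mu> by (auto simp: in_keys_iff lookup_minus lookup_single when_def split: if_splits)
      moreover have "?R \<mu> = residue I ?q"
        using bc.subspace_scale[OF I r(1)] by (simp add: R)
      ultimately have "?R \<mu> \<in> quot_span I (?R ` (B - {\<mu>}))" unfolding span by blast
      \<comment> \<open>By injectivity no other element of \<open>B\<close> shares the class of
        \<open>\<mu>\<close>.\<close>
      moreover have "?R ` (B - {\<mu>}) = ?R ` B - {?R \<mu>}"
        using * \<mu>B by (subst inj_on_image_set_diff[of ?R B]) auto
      ultimately show False using * \<mu>B by auto
    qed
  next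
    assume ?ind
    show inj: "inj_on ?R B"
    proof (rule inj_onI)
      fix \<mu> \<nu> assume "\<mu> \<in> B" "\<nu> \<in> B" "?R \<mu> = ?R \<nu>"
      moreover from this have "Poly_Mapping.keys (nf \<mu> - nf \<nu> :: ('x, 'k) bc) \<subseteq> B"
        by (auto simp: in_keys_iff lookup_minus lookup_single when_def split: if_splits)
      ultimately have "(nf \<mu> - nf \<nu> :: ('x, 'k) bc) = 0" using \<open>?ind\<close> R by blast
      then have "Poly_Mapping.keys (nf \<mu> :: ('x, 'k) bc) = Poly_Mapping.keys (nf \<nu> :: ('x, 'k) bc)" by simp
      then show "\<mu> = \<nu>" by simp
    qed
    fix A assume "A \<in> ?R ` B"
    then obtain \<mu> where \<mu>: "\<mu> \<in> B" "A = ?R \<mu>" by blast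
    show "A \<notin> quot_span I (?R ` B - {A})"
    proof
      assume "A \<in> quot_span I (?R ` B - {A})"
      also have "?R ` B - {A} = ?R ` (B - {\<mu>})"
        using inj \<mu> by (subst inj_on_image_set_diff[of ?R B]) auto
      finally obtain r where r: "Poly_Mapping.keys r \<subseteq> B - {\<mu>}" "nf \<mu> - r \<in> I"
        unfolding span \<mu>(2) using R by blast
      then have "Poly_Mapping.keys (nf \<mu> - r) \<subseteq> B"
        using \<mu>(1) Poly_Mapping.keys_diff[of "nf \<mu>" r] by auto
      with r \<open>?ind\<close> have "nf \<mu> - r = 0" by blast
      then have "r = nf \<mu>" by simp
      with r show False by simp
    qed
  qed
  have "?R ` B \<subseteq> quot_carrier I" by (auto simp: carrier)
  then have "forms_quot_basis I B \<longleftrightarrow>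
    (inj_on ?R B \<and> (\<forall>A\<in>?R ` B. A \<notin> quot_span I (?R ` B - {A}))) \<and>
    quot_span I (?R ` B) = quot_carrier I"
    unfolding forms_quot_basis_def quot_basis_def by simp
  then show ?thesis by (simp only: gen ind)
qed

section \<open>The Composition-Diamond lemma\<close>

locale ordered_generators =
  fixes lt :: "'x nf \<Rightarrow> 'x nf \<Rightarrow> bool" and S :: "('x, 'k::field) bc set"
  assumes order: "monomial_order lt" and monic: "monic_set lt S"
begin

section \<open>Leading monomials\<close>

lemma lt_trans: "lt \<mu> \<nu> \<Longrightarrow> lt \<nu> \<xi> \<Longrightarrow> lt \<mu> \<xi>"
  using order unfolding monomial_order_def by (blast dest: transpD)

lemma lt_total: "\<mu> = \<nu> \<or> lt \<mu> \<nu> \<or> lt \<nu> \<mu>"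
  using order unfolding monomial_order_def by (blast dest: totalpD)

lemma wfp_lt: "wfp lt"
  using order unfolding monomial_order_def by blast

lemma lt_irrefl [simp]: "\<not> lt \<mu> \<mu>"
  using wfp_lt wfp_imp_asymp asympD by metis

lemma lt_asym: "lt \<mu> \<nu> \<Longrightarrow> \<not> lt \<nu> \<mu>"
  using lt_trans lt_irrefl by blast

lemma lt_mult_right: "lt \<mu> \<nu> \<Longrightarrow> lt (nf_mult \<mu> \<xi>) (nf_mult \<nu> \<xi>)"
  and lt_mult_left: "lt \<mu> \<nu> \<Longrightarrow> lt (nf_mult \<xi> \<mu>) (nf_mult \<xi> \<nu>)"
  using order unfolding monomial_order_def by blast+

text \<open>Bounds all monomials rather than the leading one, so that 0 is included and a subspace
  results.\<close>

definition lower :: "'x nf \<Rightarrow> ('x, 'k) bc set" where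
  "lower \<mu> = {f. Poly_Mapping.keys f \<subseteq> {\<nu>. lt \<nu> \<mu>}}"

text \<open>A linear rendering of being nonzero and monic with leading monomial
  \<open>\<mu>\<close>, recovered in \<open>monic_leadD\<close>; it passes through products without
  mentioning \<open>lead\<close>.\<close>

definition monic_lead :: "('x, 'k) bc \<Rightarrow> 'x nf \<Rightarrow> bool" where
  "monic_lead f \<mu> \<longleftrightarrow> f - nf \<mu> \<in> lower \<mu>"

lemma subspace_lower: "bc.subspace (lower \<mu>)"
  unfolding lower_def by (rule subspace_supported)

lemma lower_span: "lower \<mu> = bc.span (nf ` {\<nu>. lt \<nu> \<mu>})"
  by (simp add: lower_def span_nf)

lemma lower_mono: "lt \<mu> \<nu> \<Longrightarrow> f \<in> lower \<mu> \<Longrightarrow> f \<in> lower \<nu>"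
  unfolding lower_def using lt_trans by blast

lemma lower_mult:
  assumes "f \<in> lower \<mu>"
  shows "nf \<nu> \<star> f \<in> lower (nf_mult \<nu> \<mu>)" "f \<star> nf \<nu> \<in> lower (nf_mult \<mu> \<nu>)"
proof -
  have sub: "Poly_Mapping.keys f \<subseteq> {\<xi>. lt \<xi> \<mu>}" using assms by (simp add: lower_def)
  have "(\<lambda>(\<mu>, \<nu>). nf_mult \<mu> \<nu>) ` (Poly_Mapping.keys (nf \<nu> :: ('x, 'k) bc) \<times> Poly_Mapping.keys f)
      \<subseteq> {\<xi>. lt \<xi> (nf_mult \<nu> \<mu>)}"
    using sub lt_mult_left by auto
  from order.trans[OF keys_bc_mult this] show "nf \<nu> \<star> f \<in> lower (nf_mult \<nu> \<mu>)"
    unfolding lower_def by (rule CollectI)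
  have "(\<lambda>(\<mu>, \<nu>). nf_mult \<mu> \<nu>) ` (Poly_Mapping.keys f \<times> Poly_Mapping.keys (nf \<nu> :: ('x, 'k) bc))
      \<subseteq> {\<xi>. lt \<xi> (nf_mult \<mu> \<nu>)}"
    using sub lt_mult_right by auto
  from order.trans[OF keys_bc_mult this] show "f \<star> nf \<nu> \<in> lower (nf_mult \<mu> \<nu>)"
    unfolding lower_def by (rule CollectI)
qed

lemma monic_lead_mult:
  assumes "monic_lead f \<mu>"
  shows "monic_lead (gen z \<star> f) (nf_mult (Gen z) \<mu>)" "monic_lead (f \<star> gen z) (nf_mult \<mu> (Gen z))"
  using lower_mult[OF assms[unfolded monic_lead_def], of "Gen z"]
  by (simp_all add: monic_lead_def bc_diff_mult bc_mult_diff bc_mult_single)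

text \<open>Compatibility of the order with products carries the leading coefficient 1 through each
  factor. Since the start has the shape \<open>Br\<close>, left factors enter \<open>u\<close> and
  right factors enter \<open>v\<close>.\<close>

lemma monic_lead_LR:
  assumes "monic_lead f (Br u v)"
  shows "monic_lead (right_normed zs (left_normed f ys))
    (Br (cword_extend u (mset zs)) (cword_extend v (mset ys)))"
proof -
  have L: "monic_lead (left_normed f ys) (Br u (cword_extend v (mset ys)))"
  proof (induction ys rule: rev_induct)
    case (snoc y ys)
    from monic_lead_mult(2)[OF this, of y] show ?case by simp
  qed (simp add: assms)
  show ?thesis
  proof (induction zs)
    case (Cons z zs)
    from monic_lead_mult(1)[OF this, of z] show ?case by simp
  qed (simp add: L)
qed

lemma lead_eqI:
  assumes "\<mu> \<in> Poly_Mapping.keys f" "\<And>\<nu>. \<nu> \<in> Poly_Mapping.keys f \<Longrightarrow> \<nu> = \<mu> \<or> lt \<nu> \<mu>"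
  shows "lead lt f = \<mu>"
  unfolding lead_def
proof (rule the_equality)
  show "\<mu> \<in> Poly_Mapping.keys f \<and> (\<forall>\<nu>\<in>Poly_Mapping.keys f. \<nu> = \<mu> \<or> lt \<nu> \<mu>)"
    using assms by auto
next
  fix \<xi> assume "\<xi> \<in> Poly_Mapping.keys f \<and> (\<forall>\<nu>\<in>Poly_Mapping.keys f. \<nu> = \<xi> \<or> lt \<nu> \<xi>)"
  with assms(1) assms(2)[of \<xi>] have "\<mu> = \<xi> \<or> lt \<mu> \<xi>" "\<xi> = \<mu> \<or> lt \<xi> \<mu>" by auto
  then show "\<xi> = \<mu>" using lt_asym by auto
qed

lemma lead_in_keys:
  assumes "f \<noteq> 0"
  shows "lead lt f \<in> Poly_Mapping.keys f"
    and lead_max: "\<nu> \<in> Poly_Mapping.keys f \<Longrightarrow> \<nu> = lead lt f \<or> lt \<nu> (lead lt f)"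
proof -
  have "\<exists>\<mu>\<in>A. \<forall>\<nu>\<in>A. \<nu> = \<mu> \<or> lt \<nu> \<mu>" if "finite A" "A \<noteq> {}" for A
    using that
  proof (induction rule: finite_ne_induct)
    case (insert a A)
    then obtain \<mu> where \<mu>: "\<mu> \<in> A" "\<forall>\<nu>\<in>A. \<nu> = \<mu> \<or> lt \<nu> \<mu>" by blast
    show ?case
    proof (cases "lt \<mu> a")
      case True
      with \<mu>(2) have "\<forall>\<nu>\<in>insert a A. \<nu> = a \<or> lt \<nu> a" by (auto intro: lt_trans)
      then show ?thesis by blast
    next
      case False
      with \<mu> lt_total[of a \<mu>] have "\<forall>\<nu>\<in>insert a A. \<nu> = \<mu> \<or> lt \<nu> \<mu>" by blast
      with \<mu>(1) show ?thesis by blast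
    qed
  qed simp
  from this[of "Poly_Mapping.keys f"] assms
  obtain \<mu> where \<mu>: "\<mu> \<in> Poly_Mapping.keys f" "\<forall>\<nu>\<in>Poly_Mapping.keys f. \<nu> = \<mu> \<or> lt \<nu> \<mu>"
    by (auto simp: keys_eq_empty)
  then have "lead lt f = \<mu>" by (intro lead_eqI) auto
  with \<mu> show "lead lt f \<in> Poly_Mapping.keys f"
    "\<nu> \<in> Poly_Mapping.keys f \<Longrightarrow> \<nu> = lead lt f \<or> lt \<nu> (lead lt f)" by auto
qed

lemma minus_lead_lower:
  assumes "f \<noteq> 0"
  shows "f - bc_scale (Poly_Mapping.lookup f (lead lt f)) (nf (lead lt f)) \<in> lower (lead lt f)"
proof -
  have "lt \<nu> (lead lt f)"
    if "\<nu> \<in> Poly_Mapping.keys (f - bc_scale (Poly_Mapping.lookup f (lead lt f)) (nf (lead lt f)))" for \<nu>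
  proof -
    from that have "\<nu> \<noteq> lead lt f" by (auto simp: in_keys_iff lookup_minus lookup_single)
    moreover from this that have "\<nu> \<in> Poly_Mapping.keys f"
      by (auto simp: in_keys_iff lookup_minus lookup_single when_def)
    ultimately show ?thesis using lead_max[OF assms] by blast
  qed
  then show ?thesis unfolding lower_def by blast
qed

lemma lead_lower: "f \<in> lower \<mu> \<Longrightarrow> f \<noteq> 0 \<Longrightarrow> lt (lead lt f) \<mu>"
  using lead_in_keys(1)[of f] unfolding lower_def by auto

lemma lookup_lower: "f \<in> lower \<mu> \<Longrightarrow> Poly_Mapping.lookup f \<mu> = 0"
  using lt_irrefl[of \<mu>] unfolding lower_def by (auto simp: in_keys_iff)

lemma lead_add_lower:
  assumes "g \<in> lower \<mu>" "c \<noteq> 0"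
  shows "lead lt (bc_scale c (nf \<mu>) + g) = \<mu>"
proof (rule lead_eqI)
  show "\<mu> \<in> Poly_Mapping.keys (bc_scale c (nf \<mu>) + g)"
    using assms lookup_lower by (simp add: in_keys_iff lookup_add)
  fix \<nu> assume "\<nu> \<in> Poly_Mapping.keys (bc_scale c (nf \<mu>) + g)"
  then have "\<nu> = \<mu> \<or> \<nu> \<in> Poly_Mapping.keys g"
    by (auto simp: in_keys_iff lookup_add lookup_single when_def split: if_splits)
  with assms(1) show "\<nu> = \<mu> \<or> lt \<nu> \<mu>" unfolding lower_def by blast
qed

lemma monic_leadD:
  assumes "monic_lead f \<mu>"
  shows "lead lt f = \<mu>" "Poly_Mapping.lookup f \<mu> = 1" "f \<noteq> 0"
proof -
  show "lead lt f = \<mu>"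
    using lead_add_lower[of "f - nf \<mu>" \<mu> 1] assms by (simp add: monic_lead_def)
  show 1: "Poly_Mapping.lookup f \<mu> = 1"
    using lookup_lower[of "f - nf \<mu>" \<mu>] assms by (simp add: monic_lead_def lookup_minus)
  show "f \<noteq> 0" using 1 by auto
qed

lemma monic_lead_diff: "monic_lead f \<mu> \<Longrightarrow> monic_lead g \<mu> \<Longrightarrow> f - g \<in> lower \<mu>"
  unfolding monic_lead_def using bc.subspace_diff[OF subspace_lower, of "f - nf \<mu>" \<mu> "g - nf \<mu>"] by simp

lemma monic_lead_generator: "f \<in> S \<Longrightarrow> monic_lead f (lead lt f)"
  using monic minus_lead_lower[of f] unfolding monic_set_def monic_lead_def by fastforce

section \<open>Spans of normal S-polynomials\<close>

text \<open>A member of \<open>S\<close> whose leading monomial has length at least 2 is put into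
  the second case, with empty lists, so that the first case keeps only leading monomials in
  X.\<close>

lemma normal_spolys_cases:
  assumes "h \<in> normal_spolys lt S"
  obtains (Gen) x where "h \<in> S" "lead lt h = Gen x"
  | (Br) f u v zs ys where "f \<in> S" "lead lt f = Br u v" "h = right_normed zs (left_normed f ys)"
  using assms
proof cases
  case self
  show thesis
  proof (cases "lead lt h")
    case (Gen x)
    with self that(1) show thesis by blast
  next
    case (Br u v)
    with self that(2)[of h u v "[]" "[]"] show thesis by simp
  qed
next
  case (extend s zs ys)
  then show thesis using that(2) nf_length_ge_2 by blast
qed

lemma normal_spolysI:
  "f \<in> S \<Longrightarrow> lead lt f = Br u v \<Longrightarrow> right_normed zs (left_normed f ys) \<in> normal_spolys lt S"
  by (rule normal_spolys.extend) (simp_all only: nf_length_Br)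

lemma lead_LR:
  assumes "f \<in> S" "lead lt f = Br u v"
  shows "lead lt (right_normed zs (left_normed f ys))
    = Br (cword_extend u (mset zs)) (cword_extend v (mset ys))"
  using monic_lead_LR[of f u v zs ys] monic_lead_generator[OF assms(1)] assms(2) monic_leadD(1) by simp

lemma monic_lead_normal:
  assumes "h \<in> normal_spolys lt S" shows "monic_lead h (lead lt h)"
  using assms
proof (cases rule: normal_spolys_cases)
  case (Br f u v zs ys)
  then show ?thesis
    using monic_lead_LR[of f u v zs ys] monic_lead_generator[of f] lead_LR by simp
qed (rule monic_lead_generator)

text \<open>One predicate on leading monomials covers the strict bound, the weak bound and, when
  constantly true, the whole span.\<close>

abbreviation nspan :: "('x nf \<Rightarrow> bool) \<Rightarrow> ('x, 'k) bc set" where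
  "nspan P \<equiv> bc.span {p \<in> normal_spolys lt S. P (lead lt p)}"

abbreviation below :: "'x nf \<Rightarrow> ('x, 'k) bc set" where
  "below \<mu> \<equiv> nspan (\<lambda>\<nu>. lt \<nu> \<mu>)"

abbreviation below_eq :: "'x nf \<Rightarrow> ('x, 'k) bc set" where
  "below_eq \<mu> \<equiv> nspan (\<lambda>\<nu>. \<nu> = \<mu> \<or> lt \<nu> \<mu>)"

lemma nspan_mono: "f \<in> nspan P \<Longrightarrow> (\<And>\<nu>. P \<nu> \<Longrightarrow> Q \<nu>) \<Longrightarrow> f \<in> nspan Q"
  using bc.span_mono[of "{p \<in> normal_spolys lt S. P (lead lt p)}" "{p \<in> normal_spolys lt S. Q (lead lt p)}"]
  by blast

lemma below_eq_below: "f \<in> below_eq \<mu> \<Longrightarrow> lt \<mu> \<nu> \<Longrightarrow> f \<in> below \<nu>"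
  by (erule nspan_mono) (use lt_trans in blast)

lemma below_imp_below_eq: "f \<in> below \<mu> \<Longrightarrow> f \<in> below_eq \<mu>"
  by (erule nspan_mono) blast

lemma normal_below_eq: "h \<in> normal_spolys lt S \<Longrightarrow> h \<in> below_eq (lead lt h)"
  by (rule bc.span_base) simp

lemma LR_below_eq:
  "f \<in> S \<Longrightarrow> lead lt f = Br u v \<Longrightarrow> right_normed zs (left_normed f ys)
    \<in> below_eq (Br (cword_extend u (mset zs)) (cword_extend v (mset ys)))"
  using normal_below_eq[OF normal_spolysI, of f u v zs ys] lead_LR[of f u v zs ys] by simp

lemma below_lower: "f \<in> below \<mu> \<Longrightarrow> f \<in> lower \<mu>"
proof (induction rule: bc.span_induct_alt)
  case base
  show ?case by (rule bc.subspace_0[OF subspace_lower])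
next
  case (step c p f)
  then have "p - nf (lead lt p) \<in> lower \<mu>" "nf (lead lt p) \<in> lower \<mu>"
    using monic_lead_normal[of p] lower_mono[of "lead lt p" \<mu>]
    by (auto simp: monic_lead_def lower_def)
  from bc.subspace_add[OF subspace_lower this] have "p \<in> lower \<mu>" by simp
  with step show ?case
    by (intro bc.subspace_add[OF subspace_lower] bc.subspace_scale[OF subspace_lower])
qed

text \<open>The largest leading monomial among the finitely many terms serves as
  \<open>\<mu>\<close>. This turns a strict bound into a weak bound at a smaller monomial, as the
  descent requires. For \<open>f = 0\<close> there may be no term, hence no
  \<open>\<mu>\<close>.\<close>

lemma nspan_bounded: "f \<in> nspan P \<Longrightarrow> f \<noteq> 0 \<Longrightarrow> \<exists>\<mu>. P \<mu> \<and> f \<in> below_eq \<mu>"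
proof (induction rule: bc.span_induct_alt)
  case (step c p f)
  have p: "P (lead lt p)" "p \<in> below_eq (lead lt p)"
    using step.hyps normal_below_eq by blast+
  show ?case
  proof (cases "f = 0")
    case True
    then show ?thesis using bc.span_scale[OF p(2), of c] p(1) by auto
  next
    case False
    with step obtain \<mu> where \<mu>: "P \<mu>" "f \<in> below_eq \<mu>" by blast
    define \<nu> where "\<nu> = (if lt \<mu> (lead lt p) then lead lt p else \<mu>)"
    have "f \<in> below_eq \<nu>" "p \<in> below_eq \<nu>" "P \<nu>"
      using \<mu> p lt_total[of \<mu> "lead lt p"] below_eq_below below_imp_below_eq by (auto simp: \<nu>_def)
    then show ?thesis using bc.span_add[OF bc.span_scale] by blast
  qed
qed simp

section \<open>Trivial compositions and multiplication of the spans\<close>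

context
  assumes triv: "all_compositions_trivial lt S"
begin

lemma composition_trivial: "(h, \<mu>) \<in> compositions lt S \<Longrightarrow> h \<in> below \<mu>"
  using triv unfolding all_compositions_trivial_def by blast

lemma mult_composition_trivial: "h \<in> mult_compositions lt S \<Longrightarrow> h \<in> below_eq (lead lt h)"
  using triv unfolding all_compositions_trivial_def by blast

text \<open>Triviality bounds each composition by its own leading monomial, which
  \<open>monic_lead_mult\<close> identifies with the product of the leading monomials.\<close>

lemma mult_linear_generator:
  assumes "f \<in> S" "lead lt f = Gen x"
  shows "gen z \<star> f \<in> below_eq (nf_mult (Gen z) (lead lt f))" "f \<star> gen z \<in> below_eq (nf_mult (lead lt f) (Gen z))"
  using mult_composition_trivial[OF mult_compositions.left[OF assms(1), where z = z]]
    mult_composition_trivial[OF mult_compositions.right[OF assms(1), where z = z]] assms(2)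
    monic_lead_mult[OF monic_lead_generator[OF assms(1)], of z, THEN monic_leadD(1)] by simp_all

text \<open>In the \<open>Br\<close> case a further left factor only lengthens the outer list,
  giving a normal S-polynomial again; in the \<open>Gen\<close> case the multiplication compositions
  take over.\<close>

lemma gen_mult_normal:
  assumes "p \<in> normal_spolys lt S"
  shows "gen z \<star> p \<in> below_eq (nf_mult (Gen z) (lead lt p))"
  using assms
proof (cases rule: normal_spolys_cases)
  case (Gen x)
  then show ?thesis by (rule mult_linear_generator)
next
  case (Br f u v zs ys)
  then show ?thesis
    using LR_below_eq[OF Br(1,2), of "z # zs" ys] by (simp add: lead_LR)
qed

lemma gen_mult_below:
  assumes "f \<in> below \<mu>"
  shows "gen z \<star> f \<in> below (nf_mult (Gen z) \<mu>)"
  using assms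
proof (induction rule: bc.span_induct_alt)
  case (step c p f)
  then have "gen z \<star> p \<in> below (nf_mult (Gen z) \<mu>)"
    by (intro below_eq_below[OF gen_mult_normal]) (auto intro: lt_mult_left)
  with step show ?case
    by (simp add: bc_mult_add_right bc_mult_scale_right bc.span_add bc.span_scale)
qed (simp add: bc.span_zero)

lemma right_normed_below:
  "f \<in> below (Br u v) \<Longrightarrow> right_normed zs f \<in> below (Br (cword_extend u (mset zs)) v)"
proof (induction zs)
  case (Cons z zs)
  then have "right_normed zs f \<in> below (Br (cword_extend u (mset zs)) v)" by blast
  from gen_mult_below[OF this, of z] show ?case by simp
qed simp

text \<open>Left and right multiplications by generators commute on products, so only the innermost
  factor \<open>f\<close> can obstruct the exchange; there the multiplication composition applies.\<close>

lemma gen_swap: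
  assumes f: "f \<in> S" "lead lt f = Br u v"
  shows "right_normed zs (left_normed f ys) \<star> gen y - right_normed zs (left_normed f (ys @ [y]))
    \<in> below (Br (cword_extend u (mset zs)) (cword_extend v (mset ys + {#y#})))"
proof (induction zs)
  case Nil
  show ?case by (simp add: bc.span_zero)
next
  case (Cons z zs)
  let ?t = "right_normed zs (left_normed f ys)"
  let ?\<mu> = "Br (cword_extend u (add_mset z (mset zs))) (cword_extend v (mset ys + {#y#}))"
  have 1: "gen z \<star> (?t \<star> gen y - right_normed zs (left_normed f (ys @ [y]))) \<in> below ?\<mu>"
    using gen_mult_below[OF Cons.IH, of z] by simp
  have 2: "gen z \<star> (?t \<star> gen y) - (gen z \<star> ?t) \<star> gen y \<in> below ?\<mu>"
  proof (cases "?t \<in> bc_square")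
    case True
    then show ?thesis by (simp add: square_LR_commute bc.span_zero)
  next
    case False
    then have zs: "zs = []" using bc_mult_in_square by (cases zs) auto
    with False have ys: "ys = []" using bc_mult_in_square by (cases ys rule: rev_cases) auto
    have "monic_lead (gen z \<star> (f \<star> gen y)) ?\<mu>"
      using monic_lead_mult(1)[OF monic_lead_mult(2)[OF monic_lead_generator[OF f(1)]], of z y]
      by (simp add: f zs ys letter_plus)
    \<comment> \<open>The bound of the multiplication composition is given as a \<open>lead\<close>
      and has to be identified with \<open>?\<mu>\<close>.\<close>
    then have "lead lt (gen z \<star> (f \<star> gen y)) = ?\<mu>" by (rule monic_leadD)
    then show ?thesis
      using composition_trivial[OF compositions.multiplication[OF f(1), where y = z and z = y]] False
        nf_length_Br[of u v] by (simp add: zs ys f)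
  qed
  from bc.span_diff[OF 1 2] show ?case by (simp add: bc_mult_diff)
qed

text \<open>A new right factor stands outside the left factors, so the product need not be a normal
  S-polynomial; \<open>gen_swap\<close> moves it next to \<open>f\<close> at the cost of smaller
  terms.\<close>

lemma normal_mult_gen:
  assumes "p \<in> normal_spolys lt S"
  shows "p \<star> gen z \<in> below_eq (nf_mult (lead lt p) (Gen z))"
  using assms
proof (cases rule: normal_spolys_cases)
  case (Gen x)
  then show ?thesis by (rule mult_linear_generator)
next
  case (Br f u v zs ys)
  have "right_normed zs (left_normed f (ys @ [z])) \<in> below_eq (nf_mult (lead lt p) (Gen z))"
    using LR_below_eq[OF Br(1,2), of zs "ys @ [z]"] Br
    by (simp add: lead_LR del: left_normed_simps)
  moreover have "p \<star> gen z - right_normed zs (left_normed f (ys @ [z]))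
      \<in> below_eq (nf_mult (lead lt p) (Gen z))"
    using below_imp_below_eq[OF gen_swap[OF Br(1,2), of zs ys z]] Br
    by (simp add: lead_LR del: left_normed_simps)
  ultimately show ?thesis using bc.span_add by fastforce
qed

lemma below_eq_mult_gen:
  assumes "f \<in> below_eq \<mu>"
  shows "gen z \<star> f \<in> below_eq (nf_mult (Gen z) \<mu>) \<and> f \<star> gen z \<in> below_eq (nf_mult \<mu> (Gen z))"
  using assms
proof (induction rule: bc.span_induct_alt)
  case (step c p f)
  then have p: "p \<in> normal_spolys lt S" "lead lt p = \<mu> \<or> lt (lead lt p) \<mu>" by auto
  from p(2) have "gen z \<star> p \<in> below_eq (nf_mult (Gen z) \<mu>)"
    using gen_mult_normal[OF p(1), of z] below_eq_below below_imp_below_eq lt_mult_left by blast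
  moreover from p(2) have "p \<star> gen z \<in> below_eq (nf_mult \<mu> (Gen z))"
    using normal_mult_gen[OF p(1), of z] below_eq_below below_imp_below_eq lt_mult_right by blast
  ultimately show ?case using step
    by (simp add: bc_mult_add_right bc_mult_scale_right bc_mult_add_left bc_mult_scale_left
        bc.span_add bc.span_scale)
qed (simp add: bc.span_zero)

text \<open>Multiplication by a product of normal forms splits into one left and one right
  multiplication. The same identities hold for the bounding monomials, so the bounds match.\<close>

lemma below_eq_mult_nf:
  assumes "f \<in> below_eq \<mu>"
  shows "nf \<nu> \<star> f \<in> below_eq (nf_mult \<nu> \<mu>) \<and> f \<star> nf \<nu> \<in> below_eq (nf_mult \<mu> \<nu>)"
  using assms
proof (induction \<nu> arbitrary: f \<mu> rule: nf_induct)
  case (Gen x)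
  then show ?case by (rule below_eq_mult_gen)
next
  case (mult \<nu> \<xi>)
  have prod: "nf (nf_mult \<nu> \<xi>) \<star> f = (nf \<nu> \<star> f) \<star> nf \<xi>" "f \<star> nf (nf_mult \<nu> \<xi>) = nf \<nu> \<star> (f \<star> nf \<xi>)"
    by (metis bc_mult_single bc_right_commutative mult_1)
      (metis bc_mult_single bc_left_commutative mult_1)
  have lead: "nf_mult (nf_mult \<nu> \<xi>) \<mu> = nf_mult (nf_mult \<nu> \<mu>) \<xi>"
    "nf_mult \<mu> (nf_mult \<nu> \<xi>) = nf_mult \<nu> (nf_mult \<mu> \<xi>)"
    by (rule nf_right_commutative, rule nf_left_commutative)
  from mult.IH(1)[OF mult.prems] mult.IH(2)[OF mult.prems] show ?case
    unfolding prod lead by (intro conjI) (use mult.IH in blast)+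
qed

text \<open>All monomials of \<open>g\<close> are below \<open>\<nu>\<close>, which makes the bound
  strict. This disposes of the tails of two members of \<open>S\<close> when their product is
  compared with products by leading monomials.\<close>

lemma below_eq_mult_lower:
  assumes f: "f \<in> below_eq \<mu>" and g: "g \<in> lower \<nu>"
  shows "g \<star> f \<in> below (nf_mult \<nu> \<mu>) \<and> f \<star> g \<in> below (nf_mult \<mu> \<nu>)"
  using g unfolding lower_span
proof (induction rule: bc.span_induct_alt)
  case (step c h g)
  then obtain \<xi> where \<xi>: "h = nf \<xi>" "lt \<xi> \<nu>" by blast
  have "h \<star> f \<in> below (nf_mult \<nu> \<mu>)" "f \<star> h \<in> below (nf_mult \<mu> \<nu>)"
    unfolding \<xi>(1) using below_eq_mult_nf[OF f, of \<xi>] below_eq_below lt_mult_left[OF \<xi>(2)] lt_mult_right[OF \<xi>(2)]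
    by blast+
  with step show ?case
    by (simp add: bc_mult_add_right bc_mult_scale_right bc_mult_add_left bc_mult_scale_left
        bc.span_add bc.span_scale)
qed (simp add: bc.span_zero)

section \<open>Differences of normal S-polynomials with equal leading monomials\<close>

lemma below_mult_gen:
  assumes "f \<in> below \<mu>"
  shows "f \<star> gen z \<in> below (nf_mult \<mu> (Gen z))"
  using assms
proof (induction rule: bc.span_induct_alt)
  case (step c p f)
  then have "p \<star> gen z \<in> below (nf_mult \<mu> (Gen z))"
    by (intro below_eq_below[OF normal_mult_gen]) (auto intro: lt_mult_right)
  with step show ?case
    by (simp add: bc_mult_add_left bc_mult_scale_left bc.span_add bc.span_scale)
qed (simp add: bc.span_zero)

lemma left_normed_below:
  "f \<in> below (Br u v) \<Longrightarrow> left_normed f ys \<in> below (Br u (cword_extend v (mset ys)))"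
proof (induction ys rule: rev_induct)
  case (snoc y ys)
  then have "left_normed f ys \<in> below (Br u (cword_extend v (mset ys)))" by blast
  from below_mult_gen[OF this, of y] show ?case by simp
qed simp

text \<open>Iterates \<open>gen_swap\<close>, one right factor at a time; earlier errors stay small
  because \<open>below\<close> is compatible with right multiplication.\<close>

lemma swap_below:
  assumes f: "f \<in> S" "lead lt f = Br u v"
  shows "left_normed (right_normed zs (left_normed f ys)) es - right_normed zs (left_normed f (ys @ es))
    \<in> below (Br (cword_extend u (mset zs)) (cword_extend v (mset ys + mset es)))"
proof (induction es rule: rev_induct)
  case Nil
  show ?case by (simp add: bc.span_zero)
next
  case (snoc e es)
  let ?\<mu> = "Br (cword_extend u (mset zs)) (cword_extend v (mset ys + mset (es @ [e])))"
  have "(left_normed (right_normed zs (left_normed f ys)) es - right_normed zs (left_normed f (ys @ es)))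
      \<star> gen e \<in> below ?\<mu>"
    using below_mult_gen[OF snoc.IH, of e] by simp
  moreover have "right_normed zs (left_normed f (ys @ es)) \<star> gen e
      - right_normed zs (left_normed f (ys @ es @ [e])) \<in> below ?\<mu>"
    using gen_swap[OF f, of zs "ys @ es" e] by (simp add: ac_simps)
  \<comment> \<open>The sum telescopes: the term with \<open>gen e\<close> still outside the left
    factors cancels.\<close>
  ultimately have "(left_normed (right_normed zs (left_normed f ys)) es
      - right_normed zs (left_normed f (ys @ es))) \<star> gen e
      + (right_normed zs (left_normed f (ys @ es)) \<star> gen e
      - right_normed zs (left_normed f (ys @ es @ [e]))) \<in> below ?\<mu>"
    by (rule bc.span_add)
  then show ?case by (simp add: bc_diff_mult)
qed

text \<open>If the leading monomials are coprime, the difference is controlled by comparing both terms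
  with the product \<open>f \<star> g\<close>.\<close>

lemma lcm_difference_below:
  assumes f: "f \<in> S" "lead lt f = Br u v" and g: "g \<in> S" "lead lt g = Br u' v'"
    and a: "letters (cword_lcm u u') = letters u + mset a"
    and b: "letters (cword_lcm u u') = letters u' + mset b"
    and c: "letters (cword_lcm v v') = letters v + mset c"
    and d: "letters (cword_lcm v v') = letters v' + mset d"
  shows "right_normed a (left_normed f c) - right_normed b (left_normed g d)
    \<in> below (Br (cword_lcm u u') (cword_lcm v v'))"
proof (cases "nf_length (Br (cword_lcm u u') (cword_lcm v v')) < nf_length (lead lt f) + nf_length (lead lt g)")
  case True
  show ?thesis
    by (rule composition_trivial, rule compositions.intersection[OF f(1) g(1) f(2) g(2) refl True a b c d])
next
  case False
  have disjoint: "A \<union># B = A + B" if "size (A \<inter># B) = 0" for A B :: "'x multiset"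
  proof (rule multiset_eqI)
    fix x
    have "count (A \<inter># B) x = 0" using that by simp
    then show "count (A \<union># B) x = count (A + B) x" by (auto simp: min_def max_def split: if_splits)
  qed
  have size: "size (A \<union># B) + size (A \<inter># B) = size A + size B" for A B :: "'x multiset"
    by (metis size_Un_Int)
  \<comment> \<open>The lengths of the lcm and of the two intersections add up to the total length,
    so an lcm that is not shorter leaves both intersections empty.\<close>
  from False size[of "letters u" "letters u'"] size[of "letters v" "letters v'"]
  have "size (letters u \<inter># letters u') = 0" "size (letters v \<inter># letters v') = 0"
    unfolding f g nf_length.simps letters_lcm by linarith+
  then have lcm: "letters (cword_lcm u u') = letters u + letters u'"
    "letters (cword_lcm v v') = letters v + letters v'"
    by (simp_all only: letters_lcm disjoint)
  with a b c d have ms: "mset a = letters u'" "mset b = letters u" "mset c = letters v'" "mset d = letters v"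
    unfolding lcm by (simp_all add: add.commute)
  let ?\<mu> = "Br (cword_lcm u u') (cword_lcm v v')"
  have \<mu>: "?\<mu> = nf_mult (Br u v) (Br u' v')"
    using lcm by (auto intro: cword_eqI)
  have f_low: "f - nf (Br u v) \<in> lower (Br u v)" and g_low: "g - nf (Br u' v') \<in> lower (Br u' v')"
    using monic_lead_generator[OF f(1)] monic_lead_generator[OF g(1)] f(2) g(2)
    by (simp_all add: monic_lead_def)
  have up: "f \<in> below_eq (Br u v)" "g \<in> below_eq (Br u' v')"
    using normal_below_eq[OF normal_spolys.self[OF f(1)]] normal_below_eq[OF normal_spolys.self[OF g(1)]] f(2) g(2)
    by simp_all
  have 1: "(f - nf (Br u v)) \<star> g \<in> below ?\<mu>" "f \<star> (g - nf (Br u' v')) \<in> below ?\<mu>"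
    unfolding \<mu> using below_eq_mult_lower[OF up(2) f_low] below_eq_mult_lower[OF up(1) g_low] by blast+
  \<comment> \<open>\<open>nf_Br_mult\<close> applies the left factors \<open>b\<close> before the
    right factors \<open>d\<close>; a normal S-polynomial has the opposite nesting.\<close>
  have 2: "left_normed (right_normed b g) d - right_normed b (left_normed g d) \<in> below ?\<mu>"
  proof -
    have "cword_extend u' (mset b) = cword_lcm u u'" "cword_extend v' (mset d) = cword_lcm v v'"
      by (intro cword_eqI; simp add: b[simplified] d[simplified])+
    with swap_below[OF g, of b "[]" d] show ?thesis by simp
  qed
  have "f \<star> nf (Br u' v') = right_normed a (left_normed f c)"
    "nf (Br u v) \<star> g = left_normed (right_normed b g) d"
    using ms by (simp_all only: mult_nf_Br nf_Br_mult)
  \<comment> \<open>Each product with a leading monomial is \<open>f \<star> g\<close> minus a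
    product with a tail, and the two copies of \<open>f \<star> g\<close> cancel.\<close>
  then have "right_normed a (left_normed f c) - right_normed b (left_normed g d) =
      (f - nf (Br u v)) \<star> g - f \<star> (g - nf (Br u' v'))
      + (left_normed (right_normed b g) d - right_normed b (left_normed g d))"
    by (simp add: bc_diff_mult bc_mult_diff)
  then show ?thesis by (simp only:) (intro bc.span_add bc.span_diff 1 2)
qed

text \<open>\<open>w\<close> is a common multiple of \<open>u\<close> and \<open>u'\<close>, hence a
  multiple of their lcm, with cofactor \<open>e\<close>.\<close>

lemma lcm_extend:
  assumes "cword_extend u m = w" "cword_extend u' m' = w"
  obtains a b e where "letters (cword_lcm u u') = letters u + mset a"
    "letters (cword_lcm u u') = letters u' + mset b" "m = mset a + mset e" "m' = mset b + mset e"
    "w = cword_extend (cword_lcm u u') (mset e)"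
proof -
  have w: "letters w = letters u + m" "letters w = letters u' + m'"
    using arg_cong[OF assms(1), of letters] arg_cong[OF assms(2), of letters] by simp_all
  let ?l = "letters (cword_lcm u u')"
  have l: "letters u \<subseteq># ?l" "letters u' \<subseteq># ?l" "?l \<subseteq># letters w"
  proof -
    have "letters u \<subseteq># letters w" unfolding w(1) by (rule mset_subset_eq_add_left)
    moreover have "letters u' \<subseteq># letters w" unfolding w(2) by (rule mset_subset_eq_add_left)
    ultimately show "letters u \<subseteq># ?l" "letters u' \<subseteq># ?l" "?l \<subseteq># letters w" by simp_all
  qed
  obtain a where a: "mset a = ?l - letters u" using ex_mset by blast
  obtain b where b: "mset b = ?l - letters u'" using ex_mset by blast
  obtain e where e: "mset e = letters w - ?l" using ex_mset by blast
  have a': "?l = letters u + mset a" and b': "?l = letters u' + mset b" and e': "letters w = ?l + mset e"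
    unfolding a b e by (rule l[THEN subset_mset.add_diff_inverse, symmetric])+
  have "letters u + m = letters u + (mset a + mset e)" "letters u' + m' = letters u' + (mset b + mset e)"
    using trans[OF w(1)[symmetric] trans[OF e' arg_cong[OF a', of "\<lambda>x. x + mset e"]]]
      trans[OF w(2)[symmetric] trans[OF e' arg_cong[OF b', of "\<lambda>x. x + mset e"]]]
    by (simp_all only: add.assoc)
  then have "m = mset a + mset e" "m' = mset b + mset e" by simp_all
  moreover have "w = cword_extend (cword_lcm u u') (mset e)"
    using e' by (intro cword_eqI) simp
  ultimately show thesis using that a' b' by blast
qed

text \<open>For a leading monomial in X both polynomials lie in \<open>S\<close> and the inclusion
  composition applies. Otherwise the monomial is a multiple of an lcm, and up to reordering of
  factors the difference is that of \<open>lcm_difference_below\<close>, multiplied by the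
  cofactors.\<close>

lemma normal_difference_below:
  assumes p: "p \<in> normal_spolys lt S" and q: "q \<in> normal_spolys lt S" and eq: "lead lt p = lead lt q"
  shows "p - q \<in> below (lead lt p)"
  using p
proof (cases rule: normal_spolys_cases)
  case p: (Gen x)
  \<comment> \<open>The other case would give \<open>q\<close> a leading monomial of the form
    \<open>Br\<close>.\<close>
  from q have "q \<in> S"
  proof (cases rule: normal_spolys_cases)
    case (Br f u v zs ys)
    with eq p show ?thesis by (simp add: lead_LR)
  qed
  with p eq show ?thesis
    using composition_trivial[OF compositions.inclusion[OF p(1) \<open>q \<in> S\<close> eq]] by auto
next
  case p: (Br f u v zs ys)
  from q show ?thesis
  proof (cases rule: normal_spolys_cases)
    case (Gen x)
    with eq p show ?thesis by (simp add: lead_LR)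
  next
    case q: (Br g u' v' zs' ys')
    obtain U V where UV: "lead lt p = Br U V" using p lead_LR by blast
    have U0: "cword_extend u (mset zs) = U" "cword_extend u' (mset zs') = U"
      and V0: "cword_extend v (mset ys) = V" "cword_extend v' (mset ys') = V"
      using UV eq p q by (simp_all add: lead_LR)
    from lcm_extend[OF U0] obtain a b e where
      ab: "letters (cword_lcm u u') = letters u + mset a" "letters (cword_lcm u u') = letters u' + mset b"
      and zs: "mset zs = mset a + mset e" "mset zs' = mset b + mset e"
      and U: "U = cword_extend (cword_lcm u u') (mset e)" .
    from lcm_extend[OF V0] obtain c d e' where
      cd: "letters (cword_lcm v v') = letters v + mset c" "letters (cword_lcm v v') = letters v' + mset d"
      and ys: "mset ys = mset c + mset e'" "mset ys' = mset d + mset e'"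
      and V: "V = cword_extend (cword_lcm v v') (mset e')" .
    define D where "D = right_normed a (left_normed f c) - right_normed b (left_normed g d)"
    have "D \<in> below (Br (cword_lcm u u') (cword_lcm v v'))"
      unfolding D_def by (rule lcm_difference_below[OF p(1,2) q(1,2) ab cd])
    from right_normed_below[OF left_normed_below[OF this, of e'], of e]
    have D: "right_normed e (left_normed D e') \<in> below (Br U V)" by (simp add: U V)
    have lcm: "cword_extend u (mset a) = cword_lcm u u'" "cword_extend u' (mset b) = cword_lcm u u'"
      "cword_extend v (mset c) = cword_lcm v v'" "cword_extend v' (mset d) = cword_lcm v v'"
      using ab cd by (auto intro!: cword_eqI)
    have ext: "cword_extend (cword_extend u (mset a)) (mset e) = U" "cword_extend (cword_extend u' (mset b)) (mset e) = U"
      "cword_extend v (mset c + mset e') = V" "cword_extend v' (mset d + mset e') = V"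
      by (simp_all only: U V lcm extend_extend[symmetric])
    \<comment> \<open>The cofactor \<open>e'\<close> acts outside the left factors \<open>a\<close>,
      whereas in \<open>p\<close> all right factors stand next to \<open>f\<close>.\<close>
    have P: "right_normed e (left_normed (right_normed a (left_normed f c)) e') - p \<in> below (Br U V)"
    proof -
      have "left_normed f ys = left_normed f (c @ e')"
        by (rule left_normed_cong) (simp add: ys)
      moreover have "right_normed zs t = right_normed (e @ a) t" for t :: "('x, 'k) bc"
        by (rule right_normed_cong) (simp add: zs)
      ultimately have p': "p = right_normed (e @ a) (left_normed f (c @ e'))"
        unfolding p(3) by (simp only:)
      from right_normed_below[OF swap_below[OF p(1,2), of a c e'], of e] show ?thesis
        unfolding ext p' by (simp only: right_normed_diff right_normed_simps)
    qed
    have Q: "right_normed e (left_normed (right_normed b (left_normed g d)) e') - q \<in> below (Br U V)"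
    proof -
      have "left_normed g ys' = left_normed g (d @ e')"
        by (rule left_normed_cong) (simp add: ys)
      moreover have "right_normed zs' t = right_normed (e @ b) t" for t :: "('x, 'k) bc"
        by (rule right_normed_cong) (simp add: zs)
      ultimately have q': "q = right_normed (e @ b) (left_normed g (d @ e'))"
        unfolding q(3) by (simp only:)
      from right_normed_below[OF swap_below[OF q(1,2), of b d e'], of e] show ?thesis
        unfolding ext q' by (simp only: right_normed_diff right_normed_simps)
    qed
    have "p - q = right_normed e (left_normed D e')
        - (right_normed e (left_normed (right_normed a (left_normed f c)) e') - p)
        + (right_normed e (left_normed (right_normed b (left_normed g d)) e') - q)"
      by (simp add: D_def left_normed_diff right_normed_diff)
    then show ?thesis
      unfolding UV by (simp only:) (intro bc.span_add bc.span_diff D P Q)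
  qed
qed

lemma Id_subset_span_normal: "bc_Id S \<subseteq> bc.span (normal_spolys lt S)"
proof -
  have nspan: "bc.span (normal_spolys lt S) = nspan (\<lambda>_. True)" by simp
  have closed: "gen z \<star> f \<in> nspan (\<lambda>_. True) \<and> f \<star> gen z \<in> nspan (\<lambda>_. True)"
    if "f \<in> nspan (\<lambda>_. True)" for f z
  proof (cases "f = 0")
    case True
    then show ?thesis by (simp add: bc.span_zero)
  next
    case False
    \<comment> \<open>Products with generators are controlled for bounded elements, so a bound is
      chosen first.\<close>
    with nspan_bounded[OF that] obtain \<mu> where "f \<in> below_eq \<mu>" by blast
    moreover have "below_eq \<nu> \<subseteq> nspan (\<lambda>_. True)" for \<nu> by (rule bc.span_mono) blast
    ultimately show ?thesis using below_eq_mult_gen by blast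
  qed
  have "bc_ideal (nspan (\<lambda>_. True))"
    by (rule bc_ideal_if_mult_gens) (use closed in \<open>auto simp: bc.subspace_span\<close>)
  moreover have "S \<subseteq> nspan (\<lambda>_. True)"
    by (auto intro: bc.span_base normal_spolys.self)
  ultimately show ?thesis unfolding bc_Id_def nspan by (intro hull_minimal)
qed

text \<open>Descent on the bound: either \<open>f\<close> has a smaller one, or a single normal
  S-polynomial \<open>h\<close> with leading monomial \<open>\<mu>\<close> absorbs all terms leading
  in \<open>\<mu>\<close>, which leaves a nonzero multiple of \<open>h\<close> plus smaller
  terms.\<close>

lemma lead_below_eq: "f \<in> below_eq \<mu> \<Longrightarrow> f \<noteq> 0 \<Longrightarrow> \<exists>h\<in>normal_spolys lt S. lead lt f = lead lt h"
proof (induction \<mu> arbitrary: f rule: wfp_induct_rule[OF wfp_lt])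
  case (1 \<mu>)
  show ?case
  proof (cases "f \<in> below \<mu>")
    case True
    with 1 nspan_bounded[OF True] show ?thesis by blast
  next
    case False
    then have "\<not> below_eq \<mu> \<subseteq> below \<mu>" using 1(2) by blast
    \<comment> \<open>Without a normal S-polynomial leading in \<open>\<mu>\<close> the weak and the
      strict bound would coincide.\<close>
    moreover have "below_eq \<mu> \<subseteq> below \<mu>" if "\<And>h. h \<in> normal_spolys lt S \<Longrightarrow> lead lt h \<noteq> \<mu>"
      by (rule bc.span_mono) (use that in blast)
    ultimately obtain h where h: "h \<in> normal_spolys lt S" "lead lt h = \<mu>" by blast
    from 1(2) have "\<exists>c. f - bc_scale c h \<in> below \<mu>"
    proof (induction rule: bc.span_induct_alt)
      case base
      show ?case by (rule exI[of _ 0]) (simp add: bc.span_zero)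
    next
      case (step c p f)
      then obtain c' where c': "f - bc_scale c' h \<in> below \<mu>" by blast
      consider "lead lt p = \<mu>" | "lt (lead lt p) \<mu>" using step by blast
      then show ?case
      proof cases
        case 1
        then have "p - h \<in> below \<mu>" using normal_difference_below[of p h] step h by auto
        from bc.span_add[OF bc.span_scale[OF this, of c] c']
        have "bc_scale c p + f - bc_scale (c + c') h \<in> below \<mu>"
          by (simp add: bc.scale_right_diff_distrib bc.scale_left_distrib algebra_simps)
        then show ?thesis by blast
      next
        case 2
        then have "p \<in> below \<mu>" using step by (auto intro: bc.span_base)
        from bc.span_add[OF bc.span_scale[OF this, of c] c']
        have "bc_scale c p + f - bc_scale c' h \<in> below \<mu>" by (simp add: algebra_simps)
        then show ?thesis by blast
      qed
    qed
    then obtain c where c: "f - bc_scale c h \<in> below \<mu>" by blast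
    with False have "c \<noteq> 0" by auto
    have "h - nf \<mu> \<in> lower \<mu>" using monic_lead_normal h unfolding monic_lead_def by blast
    from bc.subspace_add[OF subspace_lower bc.subspace_scale[OF subspace_lower this, of c] below_lower[OF c]]
    have "f - bc_scale c (nf \<mu>) \<in> lower \<mu>"
      by (simp add: bc.scale_right_diff_distrib)
    from lead_add_lower[OF this \<open>c \<noteq> 0\<close>] have "lead lt f = \<mu>" by simp
    with h show ?thesis by blast
  qed
qed

lemma GS_if_trivial: "GS_basis lt S (bc_Id S)"
proof -
  have "\<exists>h\<in>normal_spolys lt S. lead lt f = lead lt h" if "f \<in> bc_Id S" "f \<noteq> 0" for f
  proof -
    have "f \<in> nspan (\<lambda>_. True)" using that Id_subset_span_normal by auto
    from nspan_bounded[OF this that(2)] lead_below_eq that(2) show ?thesis by blast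
  qed
  then show ?thesis unfolding GS_basis_def using monic by blast
qed

end

section \<open>From a Groebner-Shirshov basis to trivial compositions\<close>

lemma normal_in_Id: "h \<in> normal_spolys lt S \<Longrightarrow> h \<in> bc_Id S"
  using normal_spolys_in_Id by blast

lemma minus_normal_lower:
  assumes "f \<noteq> 0" "h \<in> normal_spolys lt S" "lead lt f = lead lt h"
  shows "f - bc_scale (Poly_Mapping.lookup f (lead lt f)) h \<in> lower (lead lt f)"
proof -
  let ?c = "Poly_Mapping.lookup f (lead lt f)"
  have "h - nf (lead lt f) \<in> lower (lead lt f)"
    using monic_lead_normal[OF assms(2)] by (simp add: monic_lead_def assms(3))
  from bc.subspace_diff[OF subspace_lower minus_lead_lower[OF assms(1)]
      bc.subspace_scale[OF subspace_lower this, of ?c]]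
  show ?thesis by (simp add: bc.scale_right_diff_distrib)
qed

text \<open>Division: a normal S-polynomial cancels the leading term of \<open>f\<close>, and the
  difference stays in the ideal with all monomials smaller.\<close>

lemma Id_in_below_eq:
  assumes "GS_basis lt S (bc_Id S)"
  shows "f \<in> bc_Id S \<Longrightarrow> f \<noteq> 0 \<Longrightarrow> lead lt f = \<mu> \<Longrightarrow> f \<in> below_eq \<mu>"
proof (induction \<mu> arbitrary: f rule: wfp_induct_rule[OF wfp_lt])
  case (1 \<mu>)
  then obtain h where h: "h \<in> normal_spolys lt S" "lead lt f = lead lt h"
    using assms unfolding GS_basis_def by blast
  define g where "g = f - bc_scale (Poly_Mapping.lookup f \<mu>) h"
  have g: "g \<in> lower \<mu>" using minus_normal_lower[OF 1(3) h] 1(4) by (simp add: g_def)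
  have gI: "g \<in> bc_Id S"
    unfolding g_def
    by (intro bc.subspace_diff[OF subspace_Id] bc.subspace_scale[OF subspace_Id] 1 normal_in_Id h)
  have "g \<in> below_eq \<mu>"
  proof (cases "g = 0")
    case True
    then show ?thesis by (simp add: bc.span_zero)
  next
    case False
    have "lt (lead lt g) \<mu>" using g False by (rule lead_lower)
    with 1(1)[OF this gI False refl] show ?thesis using below_eq_below below_imp_below_eq by blast
  qed
  moreover have "bc_scale (Poly_Mapping.lookup f \<mu>) h \<in> below_eq \<mu>"
    using normal_below_eq[OF h(1)] h(2) 1(4) by (simp add: bc.span_scale)
  ultimately have "g + bc_scale (Poly_Mapping.lookup f \<mu>) h \<in> below_eq \<mu>" by (rule bc.span_add)
  then show ?case by (simp add: g_def)
qed

text \<open>Every composition lies in the ideal, where \<open>Id_in_below_eq\<close> expands it. If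
  there is a reference monomial \<open>\<mu>\<close>, both terms are monic with leading monomial
  \<open>\<mu>\<close>, so the difference lies in \<open>lower \<mu>\<close> and the expansion is
  strictly below \<open>\<mu>\<close>.\<close>

lemma trivial_if_GS:
  assumes GS: "GS_basis lt S (bc_Id S)"
  shows "all_compositions_trivial lt S"
proof -
  have mult: "h \<in> below_eq (lead lt h)" if "h \<in> mult_compositions lt S" for h
  proof -
    from that have "h \<in> bc_Id S" by cases (simp_all add: Id_mult Id_inc)
    then show ?thesis using Id_in_below_eq[OF GS] bc.span_zero by (cases "h = 0") auto
  qed
  have lower: "h \<in> below \<mu>" if "h \<in> bc_Id S" "h \<in> lower \<mu>" for h \<mu>
    using Id_in_below_eq[OF GS that(1) _ refl] lead_lower[OF that(2)] below_eq_below bc.span_zero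
    by (cases "h = 0") auto
  have "h \<in> below \<mu>" if "(h, \<mu>) \<in> compositions lt S" for h \<mu>
    using that
  proof cases
    case (inclusion f g)
    have "f - g \<in> bc_Id S" by (intro bc.subspace_diff[OF subspace_Id] Id_inc inclusion)
    moreover have "f - g \<in> lower (lead lt f)"
      using inclusion monic_lead_generator by (metis monic_lead_diff)
    ultimately show ?thesis unfolding inclusion(1,2) by (rule lower)
  next
    case (multiplication f y z)
    then obtain u v where uv: "lead lt f = Br u v" using nf_length_ge_2 by blast
    have m: "monic_lead f (Br u v)" using multiplication monic_lead_generator uv by metis
    have 1: "monic_lead (gen y \<star> (f \<star> gen z)) (nf_mult (Gen y) (nf_mult (Br u v) (Gen z)))"
      by (intro monic_lead_mult m)
    have "monic_lead ((gen y \<star> f) \<star> gen z) (nf_mult (nf_mult (Gen y) (Br u v)) (Gen z))"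
      by (intro monic_lead_mult m)
    with monic_lead_diff[OF 1] have "h \<in> lower \<mu>"
      unfolding multiplication(1,2) monic_leadD(1)[OF 1] by simp
    moreover have "h \<in> bc_Id S"
      unfolding multiplication(1) using multiplication
      by (intro bc.subspace_diff[OF subspace_Id] Id_mult Id_inc)
    ultimately show ?thesis using lower by blast
  next
    case (intersection f g u v u' v' a b c d)
    have "cword_extend u (mset a) = cword_lcm u u'" "cword_extend u' (mset b) = cword_lcm u u'"
      "cword_extend v (mset c) = cword_lcm v v'" "cword_extend v' (mset d) = cword_lcm v v'"
      using intersection by (auto intro!: cword_eqI)
    then have "monic_lead (right_normed a (left_normed f c)) \<mu>" "monic_lead (right_normed b (left_normed g d)) \<mu>"
      using monic_lead_LR[of f u v a c] monic_lead_LR[of g u' v' b d] intersection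
        monic_lead_generator[of f] monic_lead_generator[of g] by simp_all
    then have "h \<in> lower \<mu>" unfolding intersection(1) by (rule monic_lead_diff)
    moreover have "h \<in> bc_Id S"
      unfolding intersection(1) using intersection
      by (intro bc.subspace_diff[OF subspace_Id] Id_right_normed Id_left_normed Id_inc)
    ultimately show ?thesis using lower by blast
  qed
  with mult show ?thesis unfolding all_compositions_trivial_def by blast
qed

section \<open>Reduction to irreducible normal forms\<close>

text \<open>Reducibility of smaller polynomials is a hypothesis, so that the step serves both in the
  induction of \<open>reduce_lower\<close> and for arbitrary \<open>f\<close> in
  \<open>reduce\<close>.\<close>

lemma reduce_step:
  assumes "f \<noteq> 0"
    and "\<And>g. g \<in> lower (lead lt f) \<Longrightarrow> \<exists>r. Poly_Mapping.keys r \<subseteq> Irr lt S \<inter> {\<nu>. lt \<nu> (lead lt f)} \<and> g - r \<in> bc_Id S"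
  shows "\<exists>r. Poly_Mapping.keys r \<subseteq> Irr lt S \<inter> {\<nu>. \<nu> = lead lt f \<or> lt \<nu> (lead lt f)} \<and> f - r \<in> bc_Id S"
proof (cases "lead lt f \<in> Irr lt S")
  case True
  let ?m = "bc_scale (Poly_Mapping.lookup f (lead lt f)) (nf (lead lt f))"
  from assms(2)[OF minus_lead_lower[OF assms(1)]] obtain r where
    r: "Poly_Mapping.keys r \<subseteq> Irr lt S \<inter> {\<nu>. lt \<nu> (lead lt f)}" "f - ?m - r \<in> bc_Id S" by blast
  have "Poly_Mapping.keys (?m + r) \<subseteq> insert (lead lt f) (Poly_Mapping.keys r)"
    by (auto simp: in_keys_iff lookup_add lookup_single when_def split: if_splits)
  with r True show ?thesis by (intro exI[of _ "?m + r"]) (auto simp: algebra_simps)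
next
  case False
  then obtain h where h: "h \<in> normal_spolys lt S" "lead lt f = lead lt h" by (auto simp: Irr_def)
  let ?m = "bc_scale (Poly_Mapping.lookup f (lead lt f)) h"
  from assms(2)[OF minus_normal_lower[OF assms(1) h]] obtain r where
    r: "Poly_Mapping.keys r \<subseteq> Irr lt S \<inter> {\<nu>. lt \<nu> (lead lt f)}" "f - ?m - r \<in> bc_Id S" by blast
  have "(f - ?m - r) + ?m \<in> bc_Id S"
    by (intro bc.subspace_add[OF subspace_Id] r bc.subspace_scale[OF subspace_Id] normal_in_Id h)
  with r show ?thesis by (intro exI[of _ r]) auto
qed

lemma reduce_lower:
  "f \<in> lower \<mu> \<Longrightarrow> \<exists>r. Poly_Mapping.keys r \<subseteq> Irr lt S \<inter> {\<nu>. lt \<nu> \<mu>} \<and> f - r \<in> bc_Id S"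
proof (induction \<mu> arbitrary: f rule: wfp_induct_rule[OF wfp_lt])
  case (1 \<mu>)
  show ?case
  proof (cases "f = 0")
    case True
    then show ?thesis by (intro exI[of _ 0]) (simp add: bc.subspace_0[OF subspace_Id])
  next
    case False
    have "lt (lead lt f) \<mu>" using 1(2) False by (rule lead_lower)
    with reduce_step[OF False 1(1)] show ?thesis using lt_trans by blast
  qed
qed

lemma reduce: "\<exists>r. Poly_Mapping.keys r \<subseteq> Irr lt S \<and> f - r \<in> bc_Id S"
proof (cases "f = 0")
  case True
  then show ?thesis by (intro exI[of _ 0]) (simp add: bc.subspace_0[OF subspace_Id])
next
  case False
  from reduce_step[OF False reduce_lower] show ?thesis by blast
qed

lemma GS_iff_Irr_basis: "GS_basis lt S (bc_Id S) \<longleftrightarrow> forms_quot_basis (bc_Id S) (Irr lt S)"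
proof
  assume GS: "GS_basis lt S (bc_Id S)"
  have "r = 0" if "r \<in> bc_Id S" "Poly_Mapping.keys r \<subseteq> Irr lt S" for r
  proof (rule ccontr)
    assume "r \<noteq> 0"
    with that GS obtain h where "h \<in> normal_spolys lt S" "lead lt r = lead lt h"
      unfolding GS_basis_def by blast
    then have "lead lt r \<notin> Irr lt S" by (auto simp: Irr_def)
    with lead_in_keys(1)[OF \<open>r \<noteq> 0\<close>] that(2) show False by blast
  qed
  with reduce show "forms_quot_basis (bc_Id S) (Irr lt S)"
    unfolding forms_quot_basis_iff[OF subspace_Id] by blast
next
  assume "forms_quot_basis (bc_Id S) (Irr lt S)"
  then have ind: "r = 0" if "r \<in> bc_Id S" "Poly_Mapping.keys r \<subseteq> Irr lt S" for r
    using that unfolding forms_quot_basis_iff[OF subspace_Id] by blast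
  have "lead lt f \<notin> Irr lt S" if f: "f \<in> bc_Id S" "f \<noteq> 0" for f
  proof
    assume irr: "lead lt f \<in> Irr lt S"
    let ?c = "Poly_Mapping.lookup f (lead lt f)"
    let ?m = "bc_scale ?c (nf (lead lt f))"
    \<comment> \<open>Only the tail is reduced. Then \<open>?m + r\<close> lies in the ideal and is
      supported on \<open>Irr lt S\<close>, yet its coefficient at the leading monomial of
      \<open>f\<close> is still \<open>?c\<close>.\<close>
    from reduce_lower[OF minus_lead_lower[OF f(2)]] obtain r where
      r: "Poly_Mapping.keys r \<subseteq> Irr lt S \<inter> {\<nu>. lt \<nu> (lead lt f)}" "f - ?m - r \<in> bc_Id S" by blast
    have "Poly_Mapping.keys (?m + r) \<subseteq> insert (lead lt f) (Poly_Mapping.keys r)"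
      by (auto simp: in_keys_iff lookup_add lookup_single when_def split: if_splits)
    with r irr have "Poly_Mapping.keys (?m + r) \<subseteq> Irr lt S" by blast
    moreover have "?m + r \<in> bc_Id S"
      using bc.subspace_diff[OF subspace_Id f(1) r(2)] by (simp add: algebra_simps)
    ultimately have "?m + r = 0" by (intro ind)
    then have "Poly_Mapping.lookup (?m + r) (lead lt f) = 0" by simp
    moreover have "Poly_Mapping.lookup r (lead lt f) = 0"
      using r(1) lookup_lower[of r "lead lt f"] unfolding lower_def by blast
    ultimately have "?c = 0" by (simp add: lookup_add)
    with lead_in_keys(1)[OF f(2)] show False by (simp add: in_keys_iff)
  qed
  then show "GS_basis lt S (bc_Id S)"
    unfolding GS_basis_def Irr_def using monic by blast
qed

end

theorem theorem3p10:
  fixes lt :: "'x::wellorder nf \<Rightarrow> 'x nf \<Rightarrow> bool"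
    and S :: "('x, 'k::field) bc set"
  assumes "monomial_order lt"
    and "monic_set lt S"
  shows "(all_compositions_trivial lt S \<longleftrightarrow> GS_basis lt S (bc_Id S))
    \<and> (GS_basis lt S (bc_Id S) \<longleftrightarrow> forms_quot_basis (bc_Id S) (Irr lt S))"
proof -
  interpret ordered_generators lt S using assms by unfold_locales
  show ?thesis using GS_if_trivial trivial_if_GS GS_iff_Irr_basis by blast
qed

end
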